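(* Let $\sigma:A\to A^+$ be a substitution on a finite alphabet $A$ (with $X_\sigma$ uncountable) such that $|\sigma^n|\to\infty$, i.e. $|\sigma^n(a)|\to\infty$ for all $a\in A$. Then: (1) $$X_\sigma=\{w(\overline m):\overline m\in\mathcal M_0\}\cup\bigcup_{\overline s\in\Lambda}\mathrm{Orb}_{T_\sigma}(w(\overline s)).$$ (2) The set $\{w(\overline s):\overline s\in\Lambda\}$ is finite. (3) If $\sigma$ is aperiodic, then $$\bigcap_{n=0}^\infty\sigma^n(X_\sigma)=\{w(\overline s):\overline s\in\Lambda\}.$$
   Context: $A^+$ is the set of nonempty words over $A$; a substitution $\sigma:A\to A^+$ is extended to $A^+$ and $A^{\mathbb Z}$ by concatenation (in $\sigma(y)$ the word $\sigma(y[0])$ starts at coordinate $0$). $|\sigma|=\min_{a\in A}|\sigma(a)|$. $L(\sigma)$ is the set of all factors of $\sigma^n(a)$, $a\in A$, $n\ge1$. $X_\sigma=\{x\in A^{\mathbb Z}:x[-n,n]\in L(\sigma)\text{ for all }n\}$ and $T_\sigma$ is the left shift $(T_\sigma x)[n]=x[n+1]$; $\mathrm{Orb}_{T_\sigma}(x)=\{T_\sigma^kx:k\in\mathbb Z\}$. $\sigma$ is aperiodic if $(X_\sigma,T_\sigma)$ has no periodic points. Standing assumption of the paper: $X_\sigma$ is uncountable. Positions in a word are counted from $0$. $\Lambda$ is the set of all sequences $\overline s=\{(a_n,b_n)\}_{n\ge0}$ of pairs of letters such that, for all $n\geq 0$, $a_nb_n\in L(\sigma)$, $a_n$ is the letter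 at position $|\sigma(a_{n+1})|-1$ (the last letter) of $\sigma(a_{n+1})$, and $b_n$ is the letter at position $0$ of $\sigma(b_{n+1})$. For $\overline s\in\Lambda$, $w=w(\overline s)\in X_\sigma$ is the sequence defined by $w_{[-|\sigma^n(a_n)|,|\sigma^n(b_n)|-1]}=\sigma^n(a_n).\sigma^n(b_n)$ for all $n\ge0$ (the dot separates the negative and nonnegative coordinates). $\mathcal M$ is the set of all sequences $\overline m=\{(a_0,i_0),(a_1,i_1),\dots\}$ such that $a_j\in A$, $i_0=0$, and for $j\ge1$, $i_j\in\{0,1,\dots,|\sigma(a_j)|-1\}$ is a position of occurrence of $a_{j-1}$ in $\sigma(a_j)$. For $\overline m\in\mathcal M$ define $j_0=0$ and, writing $\sigma(a_{n+1})=a_0^{(n+1)}a_1^{(n+1)}\cdots a^{(n+1)}_{|\sigma(a_{n+1})|-1}$ with $a_i^{(n+1)}\in A$, $$j_{n+1}=|\sigma^n(a_0^{(n+1)})|+\dots+|\sigma^n(a_{i_{n+1}-1}^{(n+1)})|+j_n \text{ if } i_{n+1}\ge1,\qquad j_{n+1}=j_n\text{ if }i_{n+1}=0.$$ $\mathcal M_0$ is the set of $\overline m\in\mathcal M$ for which $j_n\to\infty$ and $|\sigma^n(a_n)|-j_n\to\infty$ as $n\to\infty$. For $\overline m\in\mathcal M_0$, $w=w(\overline m)\in X_\sigma$ is the sequence defined by $w_{[-j_n,|\sigma^n(a_n)|-j_n-1]}=\sigma^n(a_n)$ for all $n\ge0$. *)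

theory Defs
  imports Complex_Main "HOL-Library.Sublist" "HOL-Library.Countable_Set"
begin

definition substitution :: "('a \<Rightarrow> 'a list) \<Rightarrow> bool" where
  "substitution \<sigma> \<longleftrightarrow> (\<forall>a. \<sigma> a \<noteq> [])"

definition subst_word :: "('a \<Rightarrow> 'a list) \<Rightarrow> 'a list \<Rightarrow> 'a list" where
  "subst_word \<sigma> u = concat (map \<sigma> u)"

definition subst_pow :: "('a \<Rightarrow> 'a list) \<Rightarrow> nat \<Rightarrow> 'a \<Rightarrow> 'a list" where
  "subst_pow \<sigma> n a = (subst_word \<sigma> ^^ n) [a]"

definition subst_len :: "('a::finite \<Rightarrow> 'a list) \<Rightarrow> nat" where
  "subst_len \<sigma> = Min (range (\<lambda>a. length (\<sigma> a)))"

definition language :: "('a \<Rightarrow> 'a list) \<Rightarrow> 'a list set" where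
  "language \<sigma> = {u. \<exists>a n. n \<ge> 1 \<and> sublist u (subst_pow \<sigma> n a)}"

definition window :: "(int \<Rightarrow> 'a) \<Rightarrow> int \<Rightarrow> int \<Rightarrow> 'a list" where
  "window x i j = map x [i..j]"

definition subst_shift :: "('a \<Rightarrow> 'a list) \<Rightarrow> (int \<Rightarrow> 'a) set" where
  "subst_shift \<sigma> = {x. \<forall>n::nat. window x (- int n) (int n) \<in> language \<sigma>}"

text \<open>\<open>shift_by k\<close> is the \<open>k\<close>-th power of the left shift \<open>shift_by 1\<close>, for every integer \<open>k\<close>.\<close>

definition shift_by :: "int \<Rightarrow> (int \<Rightarrow> 'a) \<Rightarrow> (int \<Rightarrow> 'a)" where
  "shift_by k x = (\<lambda>n. x (n + k))"

definition shift_orbit :: "(int \<Rightarrow> 'a) \<Rightarrow> (int \<Rightarrow> 'a) set" where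
  "shift_orbit x = range (\<lambda>k. shift_by k x)"

definition aperiodic :: "('a \<Rightarrow> 'a list) \<Rightarrow> bool" where
  "aperiodic \<sigma> \<longleftrightarrow> \<not> (\<exists>x\<in>subst_shift \<sigma>. \<exists>p>0. shift_by p x = x)"

text \<open>Extension of a substitution to two-sided sequences, with \<open>\<sigma> (y 0)\<close> starting at
  coordinate 0. As \<open>\<sigma>\<close> is nonerasing, coordinate \<open>k \<ge> 0\<close> already lies in the image of
  \<open>y 0, \<dots>, y k\<close>, and coordinate \<open>k < 0\<close> in the image of \<open>y k, \<dots>, y (-1)\<close>, which ends at
  coordinate \<open>-1\<close>; \<open>subst_seq_window\<close> below is the characterization by concatenation.\<close>

definition subst_seq :: "('a \<Rightarrow> 'a list) \<Rightarrow> (int \<Rightarrow> 'a) \<Rightarrow> (int \<Rightarrow> 'a)" where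
  "subst_seq \<sigma> y = (\<lambda>k. if 0 \<le> k then subst_word \<sigma> (window y 0 k) ! nat k
     else (let u = subst_word \<sigma> (window y k (-1)) in u ! (length u - nat (- k))))"

definition Lambda_seqs :: "('a \<Rightarrow> 'a list) \<Rightarrow> (nat \<Rightarrow> 'a \<times> 'a) set" where
  "Lambda_seqs \<sigma> = {s. \<forall>n. [fst (s n), snd (s n)] \<in> language \<sigma>
      \<and> fst (s n) = last (\<sigma> (fst (s (Suc n))))
      \<and> snd (s n) = hd (\<sigma> (snd (s (Suc n))))}"

definition w_Lambda :: "('a \<Rightarrow> 'a list) \<Rightarrow> (nat \<Rightarrow> 'a \<times> 'a) \<Rightarrow> (int \<Rightarrow> 'a)" where
  "w_Lambda \<sigma> s = (THE w. \<forall>n.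
      window w (- int (length (subst_pow \<sigma> n (fst (s n)))))
               (int (length (subst_pow \<sigma> n (snd (s n)))) - 1)
        = subst_pow \<sigma> n (fst (s n)) @ subst_pow \<sigma> n (snd (s n)))"

definition M_seqs :: "('a \<Rightarrow> 'a list) \<Rightarrow> (nat \<Rightarrow> 'a \<times> nat) set" where
  "M_seqs \<sigma> = {m. snd (m 0) = 0 \<and>
      (\<forall>j. snd (m (Suc j)) < length (\<sigma> (fst (m (Suc j))))
         \<and> \<sigma> (fst (m (Suc j))) ! snd (m (Suc j)) = fst (m j))}"

text \<open>\<open>j_pos \<sigma> m n\<close> is the position in \<open>\<sigma>\<^sup>n(a\<^sub>n)\<close> of the tracked occurrence of \<open>a\<^sub>0\<close>;
  for \<open>i\<^sub>n\<^sub>+\<^sub>1 = 0\<close> the sum is empty.\<close>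

primrec j_pos :: "('a \<Rightarrow> 'a list) \<Rightarrow> (nat \<Rightarrow> 'a \<times> nat) \<Rightarrow> nat \<Rightarrow> nat" where
  "j_pos \<sigma> m 0 = 0"
| "j_pos \<sigma> m (Suc n) =
     (\<Sum>i<snd (m (Suc n)). length (subst_pow \<sigma> n (\<sigma> (fst (m (Suc n))) ! i))) + j_pos \<sigma> m n"

definition M0_seqs :: "('a \<Rightarrow> 'a list) \<Rightarrow> (nat \<Rightarrow> 'a \<times> nat) set" where
  "M0_seqs \<sigma> = {m \<in> M_seqs \<sigma>.
      filterlim (\<lambda>n. j_pos \<sigma> m n) at_top sequentially \<and>
      filterlim (\<lambda>n. int (length (subst_pow \<sigma> n (fst (m n)))) - int (j_pos \<sigma> m n))
        at_top sequentially}"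

definition w_M :: "('a \<Rightarrow> 'a list) \<Rightarrow> (nat \<Rightarrow> 'a \<times> nat) \<Rightarrow> (int \<Rightarrow> 'a)" where
  "w_M \<sigma> m = (THE w. \<forall>n.
      window w (- int (j_pos \<sigma> m n))
               (int (length (subst_pow \<sigma> n (fst (m n)))) - int (j_pos \<sigma> m n) - 1)
        = subst_pow \<sigma> n (fst (m n)))"

lemma subst_word_append: "subst_word \<sigma> (u @ v) = subst_word \<sigma> u @ subst_word \<sigma> v"
  by (simp add: subst_word_def)

lemma length_subst_word_ge:
  assumes "substitution \<sigma>"
  shows "length u \<le> length (subst_word \<sigma> u)"
proof (induction u)
  case (Cons a u)
  have "1 \<le> length (\<sigma> a)"
    using assms by (simp add: substitution_def Suc_le_eq)
  with Cons show ?case by (simp add: subst_word_def)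
qed (simp add: subst_word_def)

lemma length_window: "length (window x i j) = nat (j - i + 1)"
  by (simp add: window_def)

lemma window_append:
  assumes "i \<le> j + 1" "j \<le> k"
  shows "window x i k = window x i j @ window x (j + 1) k"
  using assms by (simp add: window_def upto_split1[of i "j + 1" k] flip: map_append)
    (metis add_diff_cancel_right' le_add_same_cancel1 upto_empty upto_split1 zle_add1_eq_le
      linorder_not_le append_Nil2 order_le_less upto_split2)

lemma subst_seq_nonneg:
  assumes "substitution \<sigma>" and "0 \<le> k" and "k < int (length (subst_word \<sigma> (window y 0 n)))"
  shows "subst_seq \<sigma> y k = subst_word \<sigma> (window y 0 n) ! nat k"
proof -
  have k: "k < int (length (subst_word \<sigma> (window y 0 k)))"
    using length_subst_word_ge[OF assms(1), of "window y 0 k"] assms(2)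
    by (simp add: length_window)
  have n: "0 \<le> n"
    using assms(2,3) by (cases "n < 0") (auto simp: window_def subst_word_def)
  have "subst_word \<sigma> (window y 0 k) ! nat k = subst_word \<sigma> (window y 0 n) ! nat k"
  proof (cases "k \<le> n")
    case True
    have "nat k < length (subst_word \<sigma> (window y 0 k))"
      using k assms(2) by linarith
    with True assms(2) show ?thesis
      by (simp add: window_append[of 0 k n] subst_word_append nth_append)
  next
    case False
    have "nat k < length (subst_word \<sigma> (window y 0 n))"
      using assms(2,3) by linarith
    with False n show ?thesis
      by (simp add: window_append[of 0 n k] subst_word_append nth_append)
  qed
  with assms(2) show ?thesis by (simp add: subst_seq_def)
qed

lemma subst_seq_neg:
  assumes "substitution \<sigma>" and "0 < k" and "k \<le> length (subst_word \<sigma> (window y n (-1)))"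
  shows "subst_seq \<sigma> y (- int k) = 
    subst_word \<sigma> (window y n (-1)) ! (length (subst_word \<sigma> (window y n (-1))) - k)"
proof -
  let ?u = "subst_word \<sigma> (window y (- int k) (-1))"
  let ?v = "subst_word \<sigma> (window y n (-1))"
  have k: "k \<le> length ?u"
    using length_subst_word_ge[OF assms(1), of "window y (- int k) (-1)"]
    by (simp add: length_window)
  have n: "n < 0"
    using assms(2,3) by (cases "n < 0") (auto simp: window_def subst_word_def)
  have "?u ! (length ?u - k) = ?v ! (length ?v - k)"
  proof (cases "n \<le> - int k")
    case True
    with assms(2) have "?v = subst_word \<sigma> (window y n (- int k - 1)) @ ?u"
      using window_append[of n "- int k - 1" "-1" y] by (simp add: subst_word_append)
    with k show ?thesis by (auto simp: nth_append)
  next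
    case False
    with n have "?u = subst_word \<sigma> (window y (- int k) (n - 1)) @ ?v"
      using window_append[of "- int k" "n - 1" "-1" y] by (simp add: subst_word_append)
    with assms(3) show ?thesis by (auto simp: nth_append)
  qed
  with assms(2) show ?thesis by (simp add: subst_seq_def Let_def)
qed

lemma subst_seq_window:
  fixes n :: nat
  assumes "substitution \<sigma>"
  shows "window (subst_seq \<sigma> y)
           (- int (length (subst_word \<sigma> (window y (- int n) (-1)))))
           (int (length (subst_word \<sigma> (window y 0 (int n - 1)))) - 1)
         = subst_word \<sigma> (window y (- int n) (-1)) @ subst_word \<sigma> (window y 0 (int n - 1))"
    (is "window ?x (- int (length ?u)) (int (length ?v) - 1) = _")
proof (rule nth_equalityI)
  fix i assume "i < length (window ?x (- int (length ?u)) (int (length ?v) - 1))"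
  then have i: "i < length ?u + length ?v" by (simp add: length_window) 
  then have eq: "window ?x (- int (length ?u)) (int (length ?v) - 1) ! i
      = ?x (int i - int (length ?u))"
    by (simp add: window_def nth_upto)
  show "window ?x (- int (length ?u)) (int (length ?v) - 1) ! i = (?u @ ?v) ! i"
  proof (cases "i < length ?u")
    case True
    then have "?x (- int (length ?u - i)) = ?u ! (length ?u - (length ?u - i))"
      by (intro subst_seq_neg assms) auto
    with True show ?thesis by (simp add: eq nth_append of_nat_diff)
  next
    case False
    then have "?x (int i - int (length ?u)) = ?v ! nat (int i - int (length ?u))"
      using i by (intro subst_seq_nonneg assms) auto
    with False show ?thesis by (simp add: eq nth_append nat_diff_distrib)
  qed
qed (simp add: length_window)

end

theory Submission
  imports Defs
begin

text \<open>
  The main tool is desubstitution: every point of the subshift is \<open>T\<^sup>k \<sigma>(y)\<close> with \<open>y\<close> in the subshift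
  and \<open>0 \<le> k < |\<sigma>(y 0)|\<close>. Long central windows of the point lie in words \<open>\<sigma>(u)\<close> with \<open>u\<close> in the language,
  and a compactness argument turns these words \<open>u\<close> into one two-sided sequence (lemma \<open>desubstitution\<close>).

  Iterating from \<open>x = y\<^sub>0\<close> gives points \<open>y\<^sub>n\<close> and offsets \<open>k\<^sub>n\<close> such that \<open>m = (y\<^sub>n 0, k\<^sub>n)\<^sub>n\<close> is in \<open>\<M>\<close> and
  \<open>x = T\<^bsup>j\<^esup> \<sigma>\<^sup>n(y\<^sub>n)\<close> with \<open>j = j\<^sub>n\<close>. Both \<open>j\<^sub>n\<close> and \<open>|\<sigma>\<^sup>n(y\<^sub>n 0)| - j\<^sub>n\<close> are nondecreasing. If both tend
  to infinity, then \<open>x = w(m)\<close>. Otherwise one of them is eventually constant, which means that from some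
  level on the tracked letter is always the first, or always the last, letter of the image that contains
  it. The boundary before, respectively after, the tracked letter is then the image of the boundary
  one level up, so \<open>x\<close> is a shift of a point with an infinite tower of exact preimages
  \<open>y\<^sub>n = \<sigma>(y\<^sub>n\<^sub>+\<^sub>1)\<close>, and the pairs of letters around the origin of such a tower form an element of \<open>\<Lambda>\<close>
  (lemma \<open>w_Lambda_of_tower\<close>).

  The set \<open>\<Lambda>\<close> itself is finite, because a pair at level \<open>n\<close> determines all pairs at lower levels, so
  that distinct elements have distinct pairs at every high level and there are only finitely many pairs.

  A point with an \<open>n\<close>-fold preimage for every \<open>n\<close> gives a finite chain of pairs of letters for every
  \<open>n\<close>; compactness selects one infinite chain from them, and this is the element of \<open>\<Lambda>\<close> that generates
  the point. Conversely \<open>w(s)\<close> is the image of \<open>w\<close> of the shifted sequence \<open>s\<close>.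
\<close>

section \<open>Windows\<close>

lemma window_eq_iff:
  "window x i j = window x' i j \<longleftrightarrow> (\<forall>k. i \<le> k \<and> k \<le> j \<longrightarrow> x k = x' k)"
  by (auto simp: window_def)

lemma window_nth: "n < nat (j - i + 1) \<Longrightarrow> window x i j ! n = x (i + int n)"
  by (simp add: window_def nth_upto)

lemma window_shift_by: "window (shift_by k x) i j = window x (i + k) (j + k)"
  by (rule nth_equalityI) (simp_all add: length_window window_nth shift_by_def algebra_simps)

lemma window_eq_append:
  assumes "window x i k = u @ v" "i \<le> k + 1"
  shows "window x i (i + int (length u) - 1) = u" "window x (i + int (length u)) k = v"
proof -
  have len: "nat (k - i + 1) = length u + length v"
    using arg_cong[OF assms(1), of length] by (simp add: length_window)
  have "window x i (i + int (length u) - 1) @ window x (i + int (length u)) k = u @ v"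
    using window_append[of i "i + int (length u) - 1" k x] len assms by auto
  then show "window x i (i + int (length u) - 1) = u" "window x (i + int (length u)) k = v"
    using len assms(2) by (auto simp: length_window)
qed

lemma window_sublist:
  assumes "i \<le> i'" "j' \<le> j"
  shows "sublist (window x i' j') (window x i j)"
proof (cases "i' \<le> j'")
  case True
  then have "window x i j = window x i (i' - 1) @ window x i' j' @ window x (j' + 1) j"
    using assms window_append[of i "i' - 1" j x] window_append[of i' j' j x] by simp
  then show ?thesis by (simp add: sublist_appendI)
qed (simp add: window_def)

lemma shift_by_shift_by: "shift_by k (shift_by l x) = shift_by (l + k) x"
  by (simp add: shift_by_def algebra_simps)

lemma eq_if_windows_eq:
  fixes l r :: "nat \<Rightarrow> int"
  assumes "\<And>n. window x (- l n) (r n - 1) = window x' (- l n) (r n - 1)"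
    and "filterlim l at_top sequentially" "filterlim r at_top sequentially"
  shows "x = x'"
proof
  fix k
  have "eventually (\<lambda>n. l n \<ge> - k \<and> r n \<ge> k + 1) sequentially"
    using assms(2,3) by (auto simp: filterlim_at_top intro: eventually_conj)
  then obtain n where "l n \<ge> - k" "r n \<ge> k + 1"
    by (auto simp: eventually_sequentially)
  with assms(1)[of n] show "x k = x' k" by (auto simp: window_eq_iff)
qed

section \<open>Words, powers and the language of a substitution\<close>

lemma subst_word_sublist: "sublist u v \<Longrightarrow> sublist (subst_word \<sigma> u) (subst_word \<sigma> v)"
  by (force simp: sublist_def subst_word_append)

lemma subst_word_subst_pow: "subst_word (subst_pow \<sigma> n) u = (subst_word \<sigma> ^^ n) u"
proof -
  have app: "(subst_word \<sigma> ^^ n) (v @ w) = (subst_word \<sigma> ^^ n) v @ (subst_word \<sigma> ^^ n) w" for v w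
    by (induction n) (simp_all add: subst_word_append)
  have Cons_word: "subst_word \<tau> (a # u) = \<tau> a @ subst_word \<tau> u" for \<tau> :: "'a \<Rightarrow> 'a list" and a u
    by (simp add: subst_word_def)
  show ?thesis
  proof (induction u)
    case Nil
    show ?case by (induction n) (simp_all add: subst_word_def)
  next
    case (Cons a u)
    then show ?case
      using app[of "[a]" u] by (simp add: subst_pow_def Cons_word)
  qed
qed

lemma subst_pow_0 [simp]: "subst_pow \<sigma> 0 = (\<lambda>a. [a])"
  by (simp add: subst_pow_def fun_eq_iff)

lemma subst_pow_Suc: "subst_pow \<sigma> (Suc n) a = subst_word (subst_pow \<sigma> n) (\<sigma> a)"
  unfolding subst_word_subst_pow subst_pow_def funpow_Suc_right by (simp add: subst_word_def)

lemma subst_pow_Suc': "subst_pow \<sigma> (Suc n) a = subst_word \<sigma> (subst_pow \<sigma> n a)"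
  by (simp add: subst_pow_def)

lemma subst_pow_add: "subst_pow \<sigma> (n + m) a = subst_word (subst_pow \<sigma> n) (subst_pow \<sigma> m a)"
  unfolding subst_word_subst_pow by (simp add: subst_pow_def funpow_add)

lemma subst_word_eq_Nil:
  assumes "substitution \<sigma>"
  shows "subst_word \<sigma> u = [] \<longleftrightarrow> u = []"
proof
  assume "subst_word \<sigma> u = []"
  with length_subst_word_ge[OF assms, of u] show "u = []" by simp
qed (simp add: subst_word_def)

lemma substitution_subst_pow:
  assumes "substitution \<sigma>"
  shows "substitution (subst_pow \<sigma> n)"
proof -
  have "subst_pow \<sigma> n a \<noteq> []" for a
    by (induction n) (simp_all add: subst_pow_Suc' subst_word_eq_Nil[OF assms])
  then show ?thesis by (simp add: substitution_def)
qed

lemma language_sublist: "u \<in> language \<sigma> \<Longrightarrow> sublist v u \<Longrightarrow> v \<in> language \<sigma>"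
  unfolding language_def using sublist_order.order_trans by blast

lemma subst_pow_in_language: "n \<ge> 1 \<Longrightarrow> subst_pow \<sigma> n a \<in> language \<sigma>"
  unfolding language_def by blast

lemma subst_pow_language:
  assumes "u \<in> language \<sigma>"
  shows "subst_word (subst_pow \<sigma> n) u \<in> language \<sigma>"
proof -
  obtain a k where "k \<ge> 1" "sublist u (subst_pow \<sigma> k a)"
    using assms unfolding language_def by blast
  then have "sublist (subst_word (subst_pow \<sigma> n) u) (subst_pow \<sigma> (n + k) a)" "n + k \<ge> 1"
    by (simp_all add: subst_pow_add subst_word_sublist)
  then show ?thesis
    using language_sublist subst_pow_in_language by metis
qed

lemma subst_word_language:
  assumes "u \<in> language \<sigma>"
  shows "subst_word \<sigma> u \<in> language \<sigma>"
proof -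
  have "subst_pow \<sigma> 1 = \<sigma>"
    by (rule ext) (simp add: subst_pow_def subst_word_def)
  with subst_pow_language[OF assms, of 1] show ?thesis by metis
qed

section \<open>The subshift\<close>

lemma window_in_language:
  assumes "x \<in> subst_shift \<sigma>"
  shows "window x i j \<in> language \<sigma>"
proof -
  let ?n = "nat (max \<bar>i\<bar> \<bar>j\<bar>)"
  have "sublist (window x i j) (window x (- int ?n) (int ?n))"
    by (rule window_sublist) auto
  with assms show ?thesis unfolding subst_shift_def by (blast intro: language_sublist)
qed

lemma shift_by_in_subst_shift: "x \<in> subst_shift \<sigma> \<Longrightarrow> shift_by k x \<in> subst_shift \<sigma>"
  using window_in_language[of x \<sigma>] by (simp add: subst_shift_def window_shift_by)

lemma in_subst_shift_if_windows:
  fixes l r :: "nat \<Rightarrow> int"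
  assumes "\<And>n. n \<ge> n0 \<Longrightarrow> window x (- l n) (r n - 1) \<in> language \<sigma>"
    and "filterlim l at_top sequentially" "filterlim r at_top sequentially"
  shows "x \<in> subst_shift \<sigma>"
proof -
  have "window x (- int k) (int k) \<in> language \<sigma>" for k
  proof -
    have "eventually (\<lambda>n. l n \<ge> int k \<and> r n \<ge> int k + 1 \<and> n \<ge> n0) sequentially"
      using assms(2,3) eventually_ge_at_top[of n0]
      by (intro eventually_conj) (simp_all add: filterlim_at_top)
    then obtain n where "l n \<ge> int k" "r n \<ge> int k + 1" "n \<ge> n0"
      by (auto simp: eventually_sequentially)
    then show ?thesis
      using assms(1)[of n] window_sublist[of "- l n" "- int k" "int k" "r n - 1" x] 
      by (auto intro: language_sublist)
  qed
  then show ?thesis by (simp add: subst_shift_def)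
qed

section \<open>Images of two-sided sequences\<close>

text \<open>The coordinate of \<open>\<sigma>(y)\<close> at which the image of the letter \<open>y i\<close> begins. Working with these
  coordinates for all integers \<open>i\<close> avoids separate arguments for the two sides of the origin.\<close>

definition cut_pos :: "('a \<Rightarrow> 'a list) \<Rightarrow> (int \<Rightarrow> 'a) \<Rightarrow> int \<Rightarrow> int" where
  "cut_pos \<sigma> y i = (if 0 \<le> i then int (length (subst_word \<sigma> (window y 0 (i - 1))))
     else - int (length (subst_word \<sigma> (window y i (-1)))))"

lemma cut_pos_diff:
  assumes "i \<le> j"
  shows "cut_pos \<sigma> y j = cut_pos \<sigma> y i + int (length (subst_word \<sigma> (window y i (j - 1))))"
proof -
  consider "0 \<le> i" | "i < 0" "0 \<le> j" | "j < 0" by linarith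
  then show ?thesis
  proof cases
    case 1
    then show ?thesis using assms window_append[of 0 "i - 1" "j - 1" y]
      by (simp add: cut_pos_def subst_word_append)
  next
    case 2
    then show ?thesis using assms window_append[of i "-1" "j - 1" y]
      by (simp add: cut_pos_def subst_word_append)
  next
    case 3
    then show ?thesis using assms window_append[of i "j - 1" "-1" y]
      by (simp add: cut_pos_def subst_word_append)
  qed
qed

lemma cut_pos_0 [simp]: "cut_pos \<sigma> y 0 = 0"
  by (simp add: cut_pos_def window_def subst_word_def)

lemma cut_pos_mono: "i \<le> j \<Longrightarrow> cut_pos \<sigma> y i \<le> cut_pos \<sigma> y j"
  using cut_pos_diff[of i j \<sigma> y] by simp

lemma cut_pos_ge:
  assumes "substitution \<sigma>" "0 \<le> i"
  shows "i \<le> cut_pos \<sigma> y i"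
  using cut_pos_diff[OF assms(2), of \<sigma> y] length_subst_word_ge[OF assms(1), of "window y 0 (i - 1)"]
  by (simp add: length_window)

lemma cut_pos_le:
  assumes "substitution \<sigma>" "i \<le> 0"
  shows "cut_pos \<sigma> y i \<le> i"
  using cut_pos_diff[OF assms(2), of \<sigma> y] length_subst_word_ge[OF assms(1), of "window y i (-1)"]
  by (simp add: length_window)

lemma window_subst_seq:
  assumes "substitution \<sigma>" "i \<le> j"
  shows "window (subst_seq \<sigma> y) (cut_pos \<sigma> y i) (cut_pos \<sigma> y j - 1) = subst_word \<sigma> (window y i (j - 1))"
proof -
  define n where "n = nat (max \<bar>i\<bar> \<bar>j\<bar>)"
  have n: "- int n \<le> i" "j \<le> int n" "- int n \<le> j" "i \<le> int n" unfolding n_def by auto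
  let ?a = "subst_word \<sigma> (window y (- int n) (i - 1))"
  let ?b = "subst_word \<sigma> (window y i (j - 1))"
  let ?c = "subst_word \<sigma> (window y j (int n - 1))"
  have split: "window y (- int n) (int n - 1) =
      window y (- int n) (i - 1) @ window y i (j - 1) @ window y j (int n - 1)"
    using window_append[of "- int n" "i - 1" "int n - 1" y]
      window_append[of i "j - 1" "int n - 1" y] n assms(2) by simp
  have "cut_pos \<sigma> y (- int n) = - int (length (subst_word \<sigma> (window y (- int n) (-1))))"
    using cut_pos_diff[of "- int n" 0 \<sigma> y] by simp
  moreover have "cut_pos \<sigma> y (int n) = int (length (subst_word \<sigma> (window y 0 (int n - 1))))"
    using cut_pos_diff[of 0 "int n" \<sigma> y] by simp
  ultimately have "window (subst_seq \<sigma> y) (cut_pos \<sigma> y (- int n)) (cut_pos \<sigma> y (int n) - 1)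
     = subst_word \<sigma> (window y (- int n) (int n - 1))"
    using subst_seq_window[OF assms(1), of y n] window_append[of "- int n" "-1" "int n - 1" y]
    by (simp add: subst_word_append)
  then have 1: "window (subst_seq \<sigma> y) (cut_pos \<sigma> y (- int n)) (cut_pos \<sigma> y (int n) - 1) = ?a @ (?b @ ?c)"
    by (simp add: split subst_word_append)
  have ci: "cut_pos \<sigma> y i = cut_pos \<sigma> y (- int n) + int (length ?a)" by (rule cut_pos_diff) (use n in auto)
  have cj: "cut_pos \<sigma> y j = cut_pos \<sigma> y i + int (length ?b)" by (rule cut_pos_diff) (use assms in auto)
  have 2: "window (subst_seq \<sigma> y) (cut_pos \<sigma> y i) (cut_pos \<sigma> y (int n) - 1) = ?b @ ?c"
    using window_eq_append(2)[OF 1] cut_pos_mono[of "- int n" "int n" \<sigma> y] by (simp add: ci)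
  show ?thesis
    using window_eq_append(1)[OF 2] cut_pos_mono[of i "int n" \<sigma> y] n by (simp add: cj)
qed

text \<open>The cuts \<open>cut_pos \<sigma> y (\<plusminus>n)\<close> tend to \<open>\<plusminus>\<infinity>\<close> because \<open>\<sigma>\<close> is nonerasing, so the windows between them
  exhaust the sequence. Identities between images are proved by checking them on these windows.\<close>

lemma subst_seq_unique:
  assumes "substitution \<sigma>"
    and "\<And>n::nat. window x (cut_pos \<sigma> y (- int n)) (cut_pos \<sigma> y (int n) - 1)
      = subst_word \<sigma> (window y (- int n) (int n - 1))"
  shows "x = subst_seq \<sigma> y"
proof
  fix k
  let ?n = "nat \<bar>k\<bar> + 1"
  have "window x (cut_pos \<sigma> y (- int ?n)) (cut_pos \<sigma> y (int ?n) - 1)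
      = window (subst_seq \<sigma> y) (cut_pos \<sigma> y (- int ?n)) (cut_pos \<sigma> y (int ?n) - 1)"
    by (rule trans[OF assms(2) window_subst_seq[OF assms(1), symmetric]]; simp)
  moreover have "cut_pos \<sigma> y (- int ?n) \<le> k"
    using cut_pos_le[OF assms(1), of "- int ?n" y] by linarith
  moreover have "k \<le> cut_pos \<sigma> y (int ?n) - 1"
    using cut_pos_ge[OF assms(1), of "int ?n" y] by linarith
  ultimately show "x k = subst_seq \<sigma> y k" by (simp only: window_eq_iff)
qed

lemma subst_seq_shift_by:
  assumes "substitution \<sigma>"
  shows "subst_seq \<sigma> (shift_by k y) = shift_by (cut_pos \<sigma> y k) (subst_seq \<sigma> y)"
proof -
  have cut: "cut_pos \<sigma> (shift_by k y) i = cut_pos \<sigma> y (i + k) - cut_pos \<sigma> y k" for i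
    using cut_pos_diff[of k "i + k" \<sigma> y] cut_pos_diff[of "i + k" k \<sigma> y]
      cut_pos_diff[of 0 i \<sigma> "shift_by k y"] cut_pos_diff[of i 0 \<sigma> "shift_by k y"]
    by (cases "0 \<le> i") (simp_all add: window_shift_by algebra_simps)
  show ?thesis
    by (rule subst_seq_unique[symmetric, OF assms])
      (simp add: window_shift_by cut window_subst_seq[OF assms] algebra_simps
         flip: diff_diff_eq)
qed

lemma subst_seq_comp:
  assumes "substitution \<sigma>" "substitution \<tau>"
  shows "subst_seq \<sigma> (subst_seq \<tau> y) = subst_seq (\<lambda>a. subst_word \<sigma> (\<tau> a)) y"
proof (rule subst_seq_unique)
  have word: "subst_word (\<lambda>a. subst_word \<sigma> (\<tau> a)) u = subst_word \<sigma> (subst_word \<tau> u)" for u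
    by (induction u) (simp_all add: subst_word_def)
  show "substitution (\<lambda>a. subst_word \<sigma> (\<tau> a))"
    using assms subst_word_eq_Nil[OF assms(1)] by (simp add: substitution_def)
  have cut: "cut_pos (\<lambda>a. subst_word \<sigma> (\<tau> a)) y i = cut_pos \<sigma> (subst_seq \<tau> y) (cut_pos \<tau> y i)" for i
    using cut_pos_diff[of 0 i "\<lambda>a. subst_word \<sigma> (\<tau> a)" y] cut_pos_diff[of i 0 "\<lambda>a. subst_word \<sigma> (\<tau> a)" y]
      cut_pos_diff[of 0 "cut_pos \<tau> y i" \<sigma> "subst_seq \<tau> y"] cut_pos_diff[of "cut_pos \<tau> y i" 0 \<sigma> "subst_seq \<tau> y"]
      cut_pos_mono[of 0 i \<tau> y] cut_pos_mono[of i 0 \<tau> y]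
      window_subst_seq[OF assms(2), of 0 i y] window_subst_seq[OF assms(2), of i 0 y]
    by (cases "0 \<le> i") (simp_all add: word)
  show "window (subst_seq \<sigma> (subst_seq \<tau> y)) (cut_pos (\<lambda>a. subst_word \<sigma> (\<tau> a)) y (- int n))
        (cut_pos (\<lambda>a. subst_word \<sigma> (\<tau> a)) y (int n) - 1)
      = subst_word (\<lambda>a. subst_word \<sigma> (\<tau> a)) (window y (- int n) (int n - 1))" for n
    using window_subst_seq[OF assms(2), of "- int n" "int n" y]
    by (simp add: cut word window_subst_seq[OF assms(1)] cut_pos_mono)
qed

lemma subst_seq_singletons [simp]: "subst_seq (\<lambda>a. [a]) y = y"
proof -
  have 1: "subst_word (\<lambda>a. [a]) u = u" for u :: "'a list"
    by (simp add: subst_word_def)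
  have "cut_pos (\<lambda>a. [a]) y i = i" for i
    using cut_pos_diff[of 0 i "\<lambda>a. [a]" y] cut_pos_diff[of i 0 "\<lambda>a. [a]" y]
    by (cases "0 \<le> i") (simp_all add: 1 length_window)
  then show ?thesis
    by (intro subst_seq_unique[symmetric]) (simp_all add: 1 substitution_def)
qed

lemma subst_seq_pow_Suc:
  assumes "substitution \<sigma>"
  shows "subst_seq (subst_pow \<sigma> (Suc n)) y = subst_seq \<sigma> (subst_seq (subst_pow \<sigma> n) y)"
    and "subst_seq (subst_pow \<sigma> (Suc n)) y = subst_seq (subst_pow \<sigma> n) (subst_seq \<sigma> y)"
proof -
  note pow = substitution_subst_pow[OF assms, of n]
  have "subst_pow \<sigma> (Suc n) = (\<lambda>a. subst_word \<sigma> (subst_pow \<sigma> n a))"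
    "subst_pow \<sigma> (Suc n) = (\<lambda>a. subst_word (subst_pow \<sigma> n) (\<sigma> a))"
    by (simp_all add: subst_pow_Suc' subst_pow_Suc[of \<sigma> n] fun_eq_iff flip: subst_pow_Suc')
  then show "subst_seq (subst_pow \<sigma> (Suc n)) y = subst_seq \<sigma> (subst_seq (subst_pow \<sigma> n) y)"
    "subst_seq (subst_pow \<sigma> (Suc n)) y = subst_seq (subst_pow \<sigma> n) (subst_seq \<sigma> y)"
    by (simp_all add: subst_seq_comp assms pow)
qed

lemma funpow_subst_seq:
  assumes "substitution \<sigma>"
  shows "(subst_seq \<sigma> ^^ n) y = subst_seq (subst_pow \<sigma> n) y"
  by (induction n) (simp_all add: subst_seq_pow_Suc(1)[OF assms])

lemma subst_seq_in_subst_shift: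
  assumes "substitution \<sigma>" "y \<in> subst_shift \<sigma>"
  shows "subst_seq \<sigma> y \<in> subst_shift \<sigma>"
proof -
  have "window (subst_seq \<sigma> y) (- int n) (int n) \<in> language \<sigma>" for n
  proof -
    have "sublist (window (subst_seq \<sigma> y) (- int n) (int n))
        (window (subst_seq \<sigma> y) (cut_pos \<sigma> y (- int n)) (cut_pos \<sigma> y (int n + 1) - 1))"
      using cut_pos_le[OF assms(1), of "- int n" y] cut_pos_ge[OF assms(1), of "int n + 1" y]
      by (intro window_sublist) linarith+
    moreover have "window (subst_seq \<sigma> y) (cut_pos \<sigma> y (- int n)) (cut_pos \<sigma> y (int n + 1) - 1) \<in> language \<sigma>"
      by (subst window_subst_seq)
        (simp_all add: assms(1) subst_word_language window_in_language[OF assms(2)])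
    ultimately show ?thesis by (rule language_sublist[rotated])
  qed
  then show ?thesis by (simp add: subst_shift_def)
qed

lemma subst_seq_pow_in_subst_shift:
  assumes "substitution \<sigma>" "y \<in> subst_shift \<sigma>"
  shows "subst_seq (subst_pow \<sigma> n) y \<in> subst_shift \<sigma>"
  by (induction n)
    (simp_all add: assms subst_seq_pow_Suc(1) subst_seq_in_subst_shift)

text \<open>The continuity of \<open>\<sigma>\<close> on two-sided sequences, which lets images pass to the limit in
  \<open>desubstitution\<close>.\<close>

lemma subst_seq_cong:
  assumes "\<And>j. \<bar>j\<bar> \<le> \<bar>i\<bar> \<Longrightarrow> y j = y' j"
  shows "subst_seq \<sigma> y i = subst_seq \<sigma> y' i"
proof -
  have "0 \<le> i \<Longrightarrow> window y 0 i = window y' 0 i" "i < 0 \<Longrightarrow> window y i (-1) = window y' i (-1)"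
    using assms by (auto simp: window_eq_iff)
  then show ?thesis by (simp add: subst_seq_def)
qed

lemma window_subst_seq_letter:
  assumes "substitution \<tau>"
  shows "window (subst_seq \<tau> y) 0 (int (length (\<tau> (y 0))) - 1) = \<tau> (y 0)"
  using window_subst_seq[OF assms, of 0 1 y] cut_pos_diff[of 0 1 \<tau> y]
  by (simp add: window_def subst_word_def)

lemma window_subst_seq_pair:
  assumes "substitution \<tau>"
  shows "window (subst_seq \<tau> y) (- int (length (\<tau> (y (-1))))) (int (length (\<tau> (y 0))) - 1)
    = \<tau> (y (-1)) @ \<tau> (y 0)"
proof -
  have "window y (-1) 0 = [y (-1), y 0]"
    by (simp add: window_def upto_rec1[of "-1"])
  moreover have "cut_pos \<tau> y 1 = int (length (\<tau> (y 0)))"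
    "cut_pos \<tau> y (-1) = - int (length (\<tau> (y (-1))))"
    using cut_pos_diff[of 0 1 \<tau> y] cut_pos_diff[of "-1" 0 \<tau> y]
    by (simp_all add: window_def subst_word_def)
  ultimately show ?thesis
    using window_subst_seq[OF assms, of "-1" 1 y] by (simp add: subst_word_def)
qed


section \<open>Compactness and desubstitution\<close>

text \<open>Koenig's lemma, or the compactness of a product of finite sets: the pigeonhole principle is applied
  to one coordinate after the other, each time passing to an infinite subset of the indices.\<close>

lemma compactness:
  fixes g :: "nat \<Rightarrow> nat \<Rightarrow> 'b"
  assumes "\<And>j. finite (range (\<lambda>n. g n j))"
  obtains f where "\<And>k. infinite {n. \<forall>j<k. g n j = f j}"
proof -
  have "\<exists>S. \<forall>k. infinite (S k) \<and> (S (Suc k) \<subseteq> S k \<and> (\<exists>v. \<forall>n\<in>S (Suc k). g n k = v))"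
  proof (rule dependent_nat_choice)
    show "\<exists>S :: nat set. infinite S" by blast
  next
    fix S :: "nat set" and k
    assume S: "infinite S"
    have "finite ((\<lambda>n. g n k) ` S)" by (rule finite_subset[OF _ assms[of k]]) auto
    from pigeonhole_infinite[OF S this]
    obtain m where "infinite {n \<in> S. g n k = g m k}" by blast
    then show "\<exists>S'. infinite S' \<and> S' \<subseteq> S \<and> (\<exists>v. \<forall>n\<in>S'. g n k = v)"
      by (intro exI[of _ "{n \<in> S. g n k = g m k}"]) auto
  qed
  then obtain S where S: "\<And>k. infinite (S k)" "\<And>k. S (Suc k) \<subseteq> S k"
    and "\<forall>k. \<exists>v. \<forall>n\<in>S (Suc k). g n k = v" by auto
  then obtain f where f: "\<And>k n. n \<in> S (Suc k) \<Longrightarrow> g n k = f k" by metis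
  have anti: "S k \<subseteq> S j" if "j \<le> k" for j k
    by (rule lift_Suc_antimono_le[of S, OF S(2) that])
  have "S k \<subseteq> {n. \<forall>j<k. g n j = f j}" for k
  proof safe
    fix n j assume "n \<in> S k" "j < k"
    with anti[of "Suc j" k] have "n \<in> S (Suc j)" by auto
    then show "g n j = f j" by (rule f)
  qed
  then have "infinite {n. \<forall>j<k. g n j = f j}" for k
    using S(1) finite_subset by blast
  then show ?thesis by (rule that)
qed

lemma locate_in_image:
  assumes "q < length (subst_word \<sigma> u)"
  obtains c where "c < length u" "length (subst_word \<sigma> (take c u)) \<le> q"
    "q < length (subst_word \<sigma> (take c u)) + length (\<sigma> (u ! c))"
proof -
  have "\<exists>c<length u. length (subst_word \<sigma> (take c u)) \<le> q \<and>
    q < length (subst_word \<sigma> (take c u)) + length (\<sigma> (u ! c))"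
    using assms
  proof (induction u rule: rev_induct)
    case Nil
    then show ?case by (simp add: subst_word_def)
  next
    case (snoc a u)
    show ?case
    proof (cases "q < length (subst_word \<sigma> u)")
      case True
      with snoc.IH obtain c where "c < length u" "length (subst_word \<sigma> (take c u)) \<le> q"
        "q < length (subst_word \<sigma> (take c u)) + length (\<sigma> (u ! c))" by blast
      then show ?thesis by (intro exI[of _ c]) (simp add: nth_append)
    next
      case False
      with snoc.prems show ?thesis
        by (intro exI[of _ "length u"]) (simp add: subst_word_def)
    qed
  qed
  with that show ?thesis by blast
qed

lemma length_subst_word_le:
  assumes "\<And>a. length (\<sigma> a) \<le> M"
  shows "length (subst_word \<sigma> u) \<le> M * length u"
proof (induction u)
  case (Cons a u)
  with assms[of a] show ?case by (simp add: subst_word_def)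
qed (simp add: subst_word_def)

text \<open>A window of length above \<open>M\<close> cannot come from \<open>\<sigma>(a)\<close>, so it lies in \<open>\<sigma>\<^sup>e(a)\<close> with \<open>e \<ge> 2\<close>, which is the
  image of the word \<open>u = \<sigma>\<^bsup>e-1\<^esup>(a)\<close> of the language. The letter of \<open>u\<close> whose image covers the origin
  becomes \<open>y 0\<close>.\<close>

lemma approximate_desubstitution:
  fixes \<sigma> :: "'a \<Rightarrow> 'a list"
  assumes "substitution \<sigma>" "x \<in> subst_shift \<sigma>" and M: "\<And>a. length (\<sigma> a) \<le> M"
  shows "\<exists>k y. k < length (\<sigma> (y 0)) \<and> window y (- int n) (int n) \<in> language \<sigma>
    \<and> (\<forall>i. \<bar>i\<bar> \<le> int n \<longrightarrow> shift_by (int k) (subst_seq \<sigma> y) i = x i)"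
proof -
  have M0: "0 < M"
    using M[of undefined] assms(1) unfolding substitution_def
    by (metis length_greater_0_conv less_le_trans)
  \<comment> \<open>A letter of \<open>u\<close> covers at most \<open>M\<close> coordinates, so this radius leaves at least \<open>n\<close> letters of \<open>u\<close>
    on each side of the one over the origin.\<close>
  define N where "N = M * (n + 2)"
  have N: "n \<le> N" "M \<le> N"
    using M0 by (cases M; simp add: N_def)+
  have "window x (- int N) (int N) \<in> language \<sigma>"
    using assms(2) by (rule window_in_language)
  then obtain a e where e: "e \<ge> 1" "sublist (window x (- int N) (int N)) (subst_pow \<sigma> e a)"
    unfolding language_def by blast
  have len: "2 * N + 1 \<le> length (subst_pow \<sigma> e a)"
    using sublist_length_le[OF e(2)] by (simp add: length_window)
  have "e \<noteq> 1"
  proof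
    assume "e = 1"
    then have "subst_pow \<sigma> e a = \<sigma> a" by (simp add: subst_pow_def subst_word_def)
    with len M[of a] N show False by simp
  qed
  with e obtain f where f: "e = Suc f" "f \<ge> 1" by (cases e) auto
  define u where "u = subst_pow \<sigma> f a"
  have u: "u \<in> language \<sigma>" unfolding u_def by (rule subst_pow_in_language[OF f(2)])
  have "sublist (window x (- int N) (int N)) (subst_word \<sigma> u)"
    using e(2) by (simp add: f(1) u_def subst_pow_Suc')
  then obtain p r where pr: "subst_word \<sigma> u = p @ window x (- int N) (int N) @ r"
    unfolding sublist_def by blast
  define q where "q = length p + N"
  have lenu: "length (subst_word \<sigma> u) = q + N + 1 + length r"
    using arg_cong[OF pr, of length] by (simp add: length_window q_def nat_add_distrib)
  then obtain c where c: "c < length u" "length (subst_word \<sigma> (take c u)) \<le> q"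
    "q < length (subst_word \<sigma> (take c u)) + length (\<sigma> (u ! c))"
    using locate_in_image[of q \<sigma> u] by auto
  define k where "k = q - length (subst_word \<sigma> (take c u))"
  \<comment> \<open>Outside \<open>u\<close> the values of \<open>y\<close> are arbitrary.\<close>
  define y where "y = (\<lambda>i. u ! nat (int c + i))"
  have yu: "window y (- int c) (int (length u) - int c - 1) = u"
    by (rule nth_equalityI) (simp_all add: length_window window_nth y_def)
  have yc: "window y (- int c) (- 1) = take c u"
    by (rule nth_equalityI) (use c(1) in \<open>simp_all add: length_window window_nth y_def\<close>)
  have cutc: "cut_pos \<sigma> y (- int c) = - int (length (subst_word \<sigma> (take c u)))"
    using cut_pos_diff[of "- int c" 0 \<sigma> y] by (simp add: yc)
  have wu: "window (subst_seq \<sigma> y) (cut_pos \<sigma> y (- int c))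
      (cut_pos \<sigma> y (int (length u) - int c) - 1) = subst_word \<sigma> u"
    using window_subst_seq[OF assms(1), of "- int c" "int (length u) - int c" y] c(1)
    by (simp add: yu)
  have cut2: "cut_pos \<sigma> y (int (length u) - int c) =
      cut_pos \<sigma> y (- int c) + int (length (subst_word \<sigma> u))"
    using cut_pos_diff[of "- int c" "int (length u) - int c" \<sigma> y] by (simp add: yu)
  have kx: "shift_by (int k) (subst_seq \<sigma> y) i = x i" if i: "\<bar>i\<bar> \<le> int n" for i
  proof -
    let ?t = "nat (int q + i)"
    have t: "int ?t = int q + i" "?t < length (subst_word \<sigma> u)" "length p \<le> ?t"
      "?t - length p < nat (2 * int N + 1)"
      using i N(1) lenu by (auto simp: q_def)
    have "subst_word \<sigma> u ! ?t = subst_seq \<sigma> y (cut_pos \<sigma> y (- int c) + int ?t)"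
      using t(2) by (subst wu[symmetric], subst window_nth) (simp_all add: cut2)
    also have "cut_pos \<sigma> y (- int c) + int ?t = i + int k"
      using c(2) t(1) by (simp add: cutc k_def)
    finally have "shift_by (int k) (subst_seq \<sigma> y) i = subst_word \<sigma> u ! ?t"
      by (simp add: shift_by_def)
    also have "\<dots> = window x (- int N) (int N) ! (?t - length p)"
      using t(3,4) by (simp add: pr nth_append length_window)
    also have "\<dots> = x (- int N + int (?t - length p))"
      by (rule window_nth) (use t(4) in simp)
    also have "- int N + int (?t - length p) = i"
      using t(1,3) by (simp add: q_def of_nat_diff)
    finally show ?thesis .
  qed
  have "length (subst_word \<sigma> (take c u)) + length (\<sigma> (u ! c)) = length (subst_word \<sigma> (take (Suc c) u))"
    using c(1) by (simp add: take_Suc_conv_app_nth subst_word_def)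
  also have "\<dots> \<le> M * Suc c"
    using length_subst_word_le[of \<sigma> M "take (Suc c) u", OF M] c(1) by simp
  finally have "M * (n + 2) < M * Suc c" using c(3) by (simp add: q_def N_def)
  then have cn: "n \<le> c" by (simp only: mult_less_cancel1) linarith
  have "length (subst_word \<sigma> u) = length (subst_word \<sigma> (take c u)) + length (subst_word \<sigma> (drop c u))"
    by (metis append_take_drop_id length_append subst_word_append)
  then have "N < length (subst_word \<sigma> (drop c u))" using lenu c(2) by linarith
  also have "\<dots> \<le> M * (length u - c)"
    using length_subst_word_le[of \<sigma> M "drop c u", OF M] by simp
  finally have "n + 2 < length u - c" by (simp only: mult_less_cancel1 N_def)
  then have "sublist (window y (- int n) (int n)) u"
    using cn window_sublist[of "- int c" "- int n" "int n" "int (length u) - int c - 1" y]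
    by (simp add: yu)
  with u have "window y (- int n) (int n) \<in> language \<sigma>" by (rule language_sublist)
  moreover have "k < length (\<sigma> (y 0))" using c by (simp add: k_def y_def)
  ultimately show ?thesis using kx by blast
qed

text \<open>The approximate preimages and their offsets, which are bounded, have a common limit by compactness.
  By continuity the image of the limit is the given point.\<close>

lemma desubstitution:
  fixes \<sigma> :: "'a::finite \<Rightarrow> 'a list"
  assumes "substitution \<sigma>" "x \<in> subst_shift \<sigma>"
  obtains k y where "y \<in> subst_shift \<sigma>" "k < length (\<sigma> (y 0))"
    "x = shift_by (int k) (subst_seq \<sigma> y)"
proof -
  define M where "M = Max (range (\<lambda>a. length (\<sigma> a)))"
  have M: "length (\<sigma> a) \<le> M" for a unfolding M_def by (rule Max_ge) auto
  have "\<forall>n. \<exists>k y. k < length (\<sigma> (y 0)) \<and> window y (- int n) (int n) \<in> language \<sigma>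
    \<and> (\<forall>i. \<bar>i\<bar> \<le> int n \<longrightarrow> shift_by (int k) (subst_seq \<sigma> y) i = x i)"
    using approximate_desubstitution[of \<sigma> x M, OF assms M] by simp
  then obtain K Y where KY: "\<And>n. K n < length (\<sigma> (Y n 0))"
    "\<And>n. window (Y n) (- int n) (int n) \<in> language \<sigma>"
    "\<And>n i. \<bar>i\<bar> \<le> int n \<Longrightarrow> shift_by (int (K n)) (subst_seq \<sigma> (Y n)) i = x i"
    by metis
  \<comment> \<open>The coordinates \<open>j\<close> and \<open>-j\<close> are paired to index by natural numbers; the offset is repeated at
    every index, so that agreement at index 0 already fixes it.\<close>
  define g where "g = (\<lambda>n j. (K n, Y n (int j), Y n (- int j)))"
  have "finite (range (\<lambda>n. g n j))" for j
  proof (rule finite_subset)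
    show "range (\<lambda>n. g n j) \<subseteq> {..M} \<times> UNIV"
      using KY(1) M by (auto simp: g_def intro: less_imp_le less_le_trans)
  qed simp
  then obtain f where f: "\<And>k. infinite {n. \<forall>j<k. g n j = f j}"
    using compactness[of g] by blast
  define k where "k = fst (f 0)"
  define y where "y i = (if 0 \<le> i then fst (snd (f (nat i))) else snd (snd (f (nat (- i)))))" for i
  have approx: "\<exists>n\<ge>b. K n = k \<and> (\<forall>i. \<bar>i\<bar> \<le> int b \<longrightarrow> y i = Y n i)" for b
  proof -
    obtain n where n: "n \<ge> b" "\<forall>j<Suc b. g n j = f j"
      using f[of "Suc b"] unfolding infinite_nat_iff_unbounded_le by blast
    have "y i = Y n i" if "\<bar>i\<bar> \<le> int b" for i
    proof -
      have "nat \<bar>i\<bar> < Suc b" using that by linarith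
      with n(2) have "g n (nat \<bar>i\<bar>) = f (nat \<bar>i\<bar>)" by blast
      then show ?thesis by (cases "0 \<le> i") (auto simp: y_def g_def dest: sym)
    qed
    moreover have "f 0 = g n 0" using n(2) by simp
    then have "K n = k" by (simp add: k_def g_def)
    ultimately show ?thesis using n(1) by blast
  qed
  show ?thesis
  proof
    have "window y (- int b) (int b) \<in> language \<sigma>" for b
    proof -
      obtain n where n: "n \<ge> b" "\<forall>i. \<bar>i\<bar> \<le> int b \<longrightarrow> y i = Y n i" using approx by blast
      then have "window y (- int b) (int b) = window (Y n) (- int b) (int b)"
        by (auto simp: window_eq_iff)
      also have "sublist \<dots> (window (Y n) (- int n) (int n))"
        using n(1) by (intro window_sublist) auto
      finally show ?thesis using KY(2) language_sublist by blast
    qed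
    then show "y \<in> subst_shift \<sigma>" by (simp add: subst_shift_def)
    show "k < length (\<sigma> (y 0))" using approx[of 0] KY(1) by force
    show "x = shift_by (int k) (subst_seq \<sigma> y)"
    proof
      fix i
      obtain n where n: "n \<ge> nat \<bar>i\<bar> + k" "K n = k"
        "\<And>j. \<bar>j\<bar> \<le> int (nat \<bar>i\<bar> + k) \<Longrightarrow> y j = Y n j" using approx by blast
      have "x i = subst_seq \<sigma> (Y n) (i + int k)"
        using KY(3)[of i n] n by (simp add: shift_by_def)
      also have "\<dots> = subst_seq \<sigma> y (i + int k)"
        by (rule subst_seq_cong) (use n(3) in auto)
      finally show "x i = shift_by (int k) (subst_seq \<sigma> y) i" by (simp add: shift_by_def)
    qed
  qed
qed

section \<open>Sequences defined by nested words\<close>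

text \<open>This is what makes both \<open>w(m)\<close> and \<open>w(s)\<close> well defined. The number \<open>l n\<close> is the position of the origin
  in \<open>W n\<close>, and each word is placed inside the next one so that the origins coincide.\<close>

lemma nested_words_limit:
  fixes W :: "nat \<Rightarrow> 'a list" and l :: "nat \<Rightarrow> nat"
  assumes nest: "\<And>n. \<exists>p q. W (Suc n) = p @ W n @ q \<and> l (Suc n) = length p + l n"
    and l: "filterlim (\<lambda>n. int (l n)) at_top sequentially"
    and r: "filterlim (\<lambda>n. int (length (W n)) - int (l n)) at_top sequentially"
  shows "\<exists>!w. \<forall>n. window w (- int (l n)) (int (length (W n)) - int (l n) - 1) = W n"
proof (rule ex_ex1I)
  have nested: "\<exists>p q. W m = p @ W n @ q \<and> l m = length p + l n" if "n \<le> m" for n m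
    using that
  proof (induction m rule: dec_induct)
    case base
    show ?case by (intro exI[of _ "[]"]) simp
  next
    case (step m)
    obtain p q where pq: "W m = p @ W n @ q" "l m = length p + l n" using step.IH by blast
    obtain p' q' where "W (Suc m) = p' @ W m @ q'" "l (Suc m) = length p' + l m"
      using nest by blast
    with pq show ?case by (intro exI[of _ "p' @ p"] exI[of _ "q @ q'"]) simp
  qed
  define covers where "covers n k \<longleftrightarrow> - int (l n) \<le> k \<and> k < int (length (W n)) - int (l n)" for n k
  have agree_le: "W m ! nat (k + int (l m)) = W n ! nat (k + int (l n))"
    if le: "n \<le> m" and cov: "covers n k" for n m k
  proof -
    obtain p q where pq: "W m = p @ W n @ q" "l m = length p + l n"
      using nested[OF le] by blast
    have "nat (k + int (l m)) = length p + nat (k + int (l n))" "nat (k + int (l n)) < length (W n)"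
      using cov by (auto simp: covers_def pq(2))
    then show ?thesis by (simp add: pq(1) nth_append)
  qed
  then have agree: "W m ! nat (k + int (l m)) = W n ! nat (k + int (l n))"
    if "covers m k" "covers n k" for n m k
    using that nat_le_linear[of n m] by metis
  have "\<exists>n. covers n k" for k
  proof -
    have "eventually (\<lambda>n. - k \<le> int (l n) \<and> k + 1 \<le> int (length (W n)) - int (l n)) sequentially"
      by (intro eventually_conj) (use l r in \<open>simp_all only: filterlim_at_top\<close>)
    then obtain n where "- k \<le> int (l n) \<and> k + 1 \<le> int (length (W n)) - int (l n)"
      by (auto simp: eventually_sequentially)
    then show ?thesis by (intro exI[of _ n]) (auto simp: covers_def)
  qed
  then obtain c where c: "\<And>k. covers (c k) k" by metis
  define w where "w k = W (c k) ! nat (k + int (l (c k)))" for k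
  have "window w (- int (l n)) (int (length (W n)) - int (l n) - 1) = W n" for n
  proof (rule nth_equalityI)
    fix i assume i: "i < length (window w (- int (l n)) (int (length (W n)) - int (l n) - 1))"
    then have "covers n (- int (l n) + int i)" by (simp add: covers_def length_window)
    from agree[OF c this] i
    show "window w (- int (l n)) (int (length (W n)) - int (l n) - 1) ! i = W n ! i"
      by (simp add: length_window window_nth w_def)
  qed (simp add: length_window)
  then show "\<exists>w. \<forall>n. window w (- int (l n)) (int (length (W n)) - int (l n) - 1) = W n" by blast
  show "w = w'"
    if "\<forall>n. window w (- int (l n)) (int (length (W n)) - int (l n) - 1) = W n"
      "\<forall>n. window w' (- int (l n)) (int (length (W n)) - int (l n) - 1) = W n" for w w'
  proof (rule eq_if_windows_eq[OF _ l r])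
    show "window w (- int (l n)) (int (length (W n)) - int (l n) - 1)
        = window w' (- int (l n)) (int (length (W n)) - int (l n) - 1)" for n
      using that by metis
  qed
qed

lemma mono_nat_eventually_const:
  fixes f :: "nat \<Rightarrow> nat"
  assumes "\<And>n. f n \<le> f (Suc n)" "\<not> filterlim f at_top sequentially"
  obtains N where "\<And>n. n \<ge> N \<Longrightarrow> f n = f N"
proof -
  have mono: "f n \<le> f m" if "n \<le> m" for n m
    by (rule lift_Suc_mono_le[of f, OF assms(1) that])
  obtain Z where Z: "\<not> eventually (\<lambda>n. Z \<le> f n) sequentially"
    using assms(2) unfolding filterlim_at_top by blast
  have "f n < Z" for n
  proof (rule ccontr)
    assume "\<not> f n < Z"
    then have "Z \<le> f m" if "m \<ge> n" for m using mono[OF that] by linarith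
    then have "eventually (\<lambda>n. Z \<le> f n) sequentially"
      by (auto simp: eventually_sequentially)
    with Z show False ..
  qed
  then have fin: "finite (range f)"
    by (intro finite_subset[of "range f" "{..<Z}"]) auto
  then have "Max (range f) \<in> range f" by (intro Max_in) auto
  then obtain N where "f N = Max (range f)" by (metis imageE)
  then have "f n \<le> f N" for n using fin by simp
  then have "f n = f N" if "n \<ge> N" for n using mono[OF that] by (simp add: le_antisym)
  then show ?thesis by (rule that)
qed

section \<open>Substitutions whose powers grow\<close>

locale growing_substitution =
  fixes \<sigma> :: "'a::finite \<Rightarrow> 'a list"
  assumes subst: "substitution \<sigma>"
    and growth: "filterlim (\<lambda>n. subst_len (subst_pow \<sigma> n)) at_top sequentially"
begin

lemma length_subst_pow_at_top:
  "filterlim (\<lambda>n. int (length (subst_pow \<sigma> n (c n)))) at_top sequentially"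
proof (rule filterlim_compose[OF filterlim_int_sequentially])
  show "filterlim (\<lambda>n. length (subst_pow \<sigma> n (c n))) at_top sequentially"
    by (rule filterlim_at_top_mono[OF growth]) (simp add: subst_len_def)
qed

subsection \<open>The sequences attached to \<open>\<Lambda>\<close>\<close>

lemma Lambda_seqsD:
  assumes "s \<in> Lambda_seqs \<sigma>"
  shows "[fst (s n), snd (s n)] \<in> language \<sigma>" "fst (s n) = last (\<sigma> (fst (s (Suc n))))"
    "snd (s n) = hd (\<sigma> (snd (s (Suc n))))"
  using assms unfolding Lambda_seqs_def by blast+

lemma Lambda_nested:
  assumes "s \<in> Lambda_seqs \<sigma>"
  shows "\<exists>p q. subst_pow \<sigma> (Suc n) (fst (s (Suc n))) @ subst_pow \<sigma> (Suc n) (snd (s (Suc n)))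
      = p @ (subst_pow \<sigma> n (fst (s n)) @ subst_pow \<sigma> n (snd (s n))) @ q
    \<and> length (subst_pow \<sigma> (Suc n) (fst (s (Suc n)))) = length p + length (subst_pow \<sigma> n (fst (s n)))"
proof -
  let ?a = "\<sigma> (fst (s (Suc n)))" and ?b = "\<sigma> (snd (s (Suc n)))"
  have "fst (s n) = last ?a" "snd (s n) = hd ?b" "?a \<noteq> []" "?b \<noteq> []"
    using Lambda_seqsD(2,3)[OF assms, of n] subst by (simp_all add: substitution_def)
  then have ab: "?a = butlast ?a @ [fst (s n)]" "?b = [snd (s n)] @ tl ?b" by simp_all
  have single: "subst_word (subst_pow \<sigma> n) [c] = subst_pow \<sigma> n c" for c
    by (simp add: subst_word_def)
  have "subst_pow \<sigma> (Suc n) (fst (s (Suc n)))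
      = subst_word (subst_pow \<sigma> n) (butlast ?a) @ subst_pow \<sigma> n (fst (s n))"
    "subst_pow \<sigma> (Suc n) (snd (s (Suc n)))
      = subst_pow \<sigma> n (snd (s n)) @ subst_word (subst_pow \<sigma> n) (tl ?b)"
    using arg_cong[OF ab(1), of "subst_word (subst_pow \<sigma> n)"]
      arg_cong[OF ab(2), of "subst_word (subst_pow \<sigma> n)"]
    by (simp_all only: subst_pow_Suc subst_word_append single)
  then show ?thesis by (metis append.assoc length_append)
qed

lemma w_Lambda_ex1:
  assumes "s \<in> Lambda_seqs \<sigma>"
  shows "\<exists>!w. \<forall>n. window w (- int (length (subst_pow \<sigma> n (fst (s n)))))
               (int (length (subst_pow \<sigma> n (snd (s n)))) - 1)
        = subst_pow \<sigma> n (fst (s n)) @ subst_pow \<sigma> n (snd (s n))"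
  using nested_words_limit[of "\<lambda>n. subst_pow \<sigma> n (fst (s n)) @ subst_pow \<sigma> n (snd (s n))"
      "\<lambda>n. length (subst_pow \<sigma> n (fst (s n)))", OF Lambda_nested[OF assms]]
    length_subst_pow_at_top[of "\<lambda>n. fst (s n)"] length_subst_pow_at_top[of "\<lambda>n. snd (s n)"]
  by simp

lemma w_Lambda_window:
  assumes "s \<in> Lambda_seqs \<sigma>"
  shows "window (w_Lambda \<sigma> s) (- int (length (subst_pow \<sigma> n (fst (s n)))))
               (int (length (subst_pow \<sigma> n (snd (s n)))) - 1)
        = subst_pow \<sigma> n (fst (s n)) @ subst_pow \<sigma> n (snd (s n))"
  using theI'[OF w_Lambda_ex1[OF assms]] unfolding w_Lambda_def by blast

lemma w_Lambda_eqI: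
  assumes "s \<in> Lambda_seqs \<sigma>"
    and "\<And>n. window w (- int (length (subst_pow \<sigma> n (fst (s n)))))
               (int (length (subst_pow \<sigma> n (snd (s n)))) - 1)
        = subst_pow \<sigma> n (fst (s n)) @ subst_pow \<sigma> n (snd (s n))"
  shows "w_Lambda \<sigma> s = w"
  unfolding w_Lambda_def by (rule the1_equality[OF w_Lambda_ex1]) (use assms in auto)

lemma w_Lambda_in_subst_shift:
  assumes "s \<in> Lambda_seqs \<sigma>"
  shows "w_Lambda \<sigma> s \<in> subst_shift \<sigma>"
proof (rule in_subst_shift_if_windows)
  fix n
  from subst_pow_language[OF Lambda_seqsD(1)[OF assms], of n n]
  show "window (w_Lambda \<sigma> s) (- int (length (subst_pow \<sigma> n (fst (s n)))))
      (int (length (subst_pow \<sigma> n (snd (s n)))) - 1) \<in> language \<sigma>"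
    by (simp add: w_Lambda_window[OF assms] subst_word_def)
qed (rule length_subst_pow_at_top)+

lemma Lambda_seqs_shift:
  "s \<in> Lambda_seqs \<sigma> \<Longrightarrow> (\<lambda>n. s (Suc n)) \<in> Lambda_seqs \<sigma>"
  unfolding Lambda_seqs_def by blast

text \<open>Applying \<open>\<sigma>\<close> to the windows \<open>\<sigma>\<^sup>n(a\<^sub>n\<^sub>+\<^sub>1).\<sigma>\<^sup>n(b\<^sub>n\<^sub>+\<^sub>1)\<close> of the left-hand argument gives the windows of
  level \<open>n + 1\<close> of \<open>w(s)\<close>, and these already determine \<open>w(s)\<close>.\<close>

lemma subst_seq_w_Lambda_Suc:
  assumes "s \<in> Lambda_seqs \<sigma>"
  shows "subst_seq \<sigma> (w_Lambda \<sigma> (\<lambda>n. s (Suc n))) = w_Lambda \<sigma> s"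
proof -
  let ?z = "w_Lambda \<sigma> (\<lambda>n. s (Suc n))"
  let ?a = "\<lambda>n. subst_pow \<sigma> n (fst (s n))" and ?b = "\<lambda>n. subst_pow \<sigma> n (snd (s n))"
  have s': "(\<lambda>n. s (Suc n)) \<in> Lambda_seqs \<sigma>" by (rule Lambda_seqs_shift[OF assms])
  have "window (subst_seq \<sigma> ?z) (- int (length (?a (Suc n)))) (int (length (?b (Suc n))) - 1)
      = ?a (Suc n) @ ?b (Suc n)" for n
  proof -
    define u where "u = subst_pow \<sigma> n (fst (s (Suc n)))"
    define v where "v = subst_pow \<sigma> n (snd (s (Suc n)))"
    have w: "window ?z (- int (length u)) (int (length v) - 1) = u @ v"
      using w_Lambda_window[OF s', of n] by (simp add: u_def v_def)
    have "window ?z (- int (length u)) (-1) = u" "window ?z 0 (int (length v) - 1) = v"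
      using window_eq_append[OF w] by simp_all
    then have "cut_pos \<sigma> ?z (- int (length u)) = - int (length (subst_word \<sigma> u))"
      "cut_pos \<sigma> ?z (int (length v)) = int (length (subst_word \<sigma> v))"
      using cut_pos_diff[of "- int (length u)" 0 \<sigma> ?z] cut_pos_diff[of 0 "int (length v)" \<sigma> ?z]
      by simp_all
    then have "window (subst_seq \<sigma> ?z) (- int (length (subst_word \<sigma> u)))
        (int (length (subst_word \<sigma> v)) - 1) = subst_word \<sigma> u @ subst_word \<sigma> v"
      using window_subst_seq[OF subst, of "- int (length u)" "int (length v)" ?z]
      by (simp add: w subst_word_append)
    then show ?thesis by (simp add: u_def v_def subst_pow_Suc')
  qed
  then show ?thesis
    by (intro eq_if_windows_eq[where l = "\<lambda>n. int (length (?a (Suc n)))"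
          and r = "\<lambda>n. int (length (?b (Suc n)))"])
      (use w_Lambda_window[OF assms, of "Suc _"]
         length_subst_pow_at_top[THEN filterlim_compose, OF filterlim_Suc] in auto)
qed

lemma w_Lambda_in_images:
  assumes "s \<in> Lambda_seqs \<sigma>"
  shows "w_Lambda \<sigma> s \<in> (subst_seq \<sigma> ^^ n) ` subst_shift \<sigma>"
  using assms
proof (induction n arbitrary: s)
  case 0
  then show ?case by (simp add: w_Lambda_in_subst_shift)
next
  case (Suc n)
  have "(\<lambda>n. s (Suc n)) \<in> Lambda_seqs \<sigma>" by (rule Lambda_seqs_shift[OF Suc.prems])
  then obtain y where "y \<in> subst_shift \<sigma>" "w_Lambda \<sigma> (\<lambda>n. s (Suc n)) = (subst_seq \<sigma> ^^ n) y"
    using Suc.IH by blast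
  then show ?case
    using subst_seq_w_Lambda_Suc[OF Suc.prems] by (intro image_eqI[of _ _ y]) simp_all
qed

lemma subst_seq_boundary:
  "subst_seq \<sigma> y 0 = hd (\<sigma> (y 0))" "subst_seq \<sigma> y (-1) = last (\<sigma> (y (-1)))"
proof -
  have ne: "\<sigma> a \<noteq> []" for a using subst by (simp add: substitution_def)
  then have "0 < length (\<sigma> (y 0))" "1 \<le> length (\<sigma> (y (-1)))"
    by (simp_all add: Suc_le_eq)
  then show "subst_seq \<sigma> y 0 = hd (\<sigma> (y 0))" "subst_seq \<sigma> y (-1) = last (\<sigma> (y (-1)))"
    using subst_seq_nonneg[OF subst, of 0 y 0] subst_seq_neg[OF subst, of 1 y "-1"]
    by (simp_all add: window_def subst_word_def hd_conv_nth last_conv_nth ne)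
qed

text \<open>The preimages \<open>z\<close> at different levels need not be related to each other; only the pairs of letters
  at the origin must match. This weak form is what compactness provides for
  \<open>all_images_imp_w_Lambda\<close>.\<close>

lemma w_Lambda_of_boundaries:
  assumes "\<And>n. \<exists>z\<in>subst_shift \<sigma>. x = subst_seq (subst_pow \<sigma> (Suc n)) z \<and>
    s (Suc n) = (z (-1), z 0) \<and> s n = (subst_seq \<sigma> z (-1), subst_seq \<sigma> z 0)"
  shows "s \<in> Lambda_seqs \<sigma>" "w_Lambda \<sigma> s = x"
proof -
  have "[fst (s n), snd (s n)] \<in> language \<sigma> \<and> fst (s n) = last (\<sigma> (fst (s (Suc n))))
      \<and> snd (s n) = hd (\<sigma> (snd (s (Suc n))))
      \<and> window x (- int (length (subst_pow \<sigma> n (fst (s n)))))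
          (int (length (subst_pow \<sigma> n (snd (s n)))) - 1)
        = subst_pow \<sigma> n (fst (s n)) @ subst_pow \<sigma> n (snd (s n))" for n
  proof -
    obtain z where z: "z \<in> subst_shift \<sigma>" "x = subst_seq (subst_pow \<sigma> (Suc n)) z"
      "s (Suc n) = (z (-1), z 0)" "s n = (subst_seq \<sigma> z (-1), subst_seq \<sigma> z 0)"
      using assms[of n] by blast
    have "window (subst_seq \<sigma> z) (-1) 0 \<in> language \<sigma>"
      using subst_seq_in_subst_shift[OF subst z(1)] by (rule window_in_language)
    moreover have "window (subst_seq \<sigma> z) (-1) 0 = [subst_seq \<sigma> z (-1), subst_seq \<sigma> z 0]"
      by (simp add: window_def upto_rec1[of "-1"])
    ultimately have "[fst (s n), snd (s n)] \<in> language \<sigma>" by (simp add: z(4))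
    then show ?thesis
      using window_subst_seq_pair[OF substitution_subst_pow[OF subst], of n "subst_seq \<sigma> z"]
      by (simp add: z(2-4) subst_seq_pow_Suc(2)[OF subst] flip: subst_seq_boundary)
  qed
  note this
  moreover from this show "s \<in> Lambda_seqs \<sigma>" unfolding Lambda_seqs_def by blast
  ultimately show "w_Lambda \<sigma> s = x" by (intro w_Lambda_eqI) blast+
qed

lemma w_Lambda_of_tower:
  assumes "\<And>n. y n \<in> subst_shift \<sigma>" "\<And>n. y n = subst_seq \<sigma> (y (Suc n))"
  shows "y 0 \<in> w_Lambda \<sigma> ` Lambda_seqs \<sigma>"
proof -
  have pow: "y 0 = subst_seq (subst_pow \<sigma> n) (y n)" for n
  proof (induction n)
    case (Suc n)
    have "subst_seq (subst_pow \<sigma> (Suc n)) (y (Suc n)) = subst_seq (subst_pow \<sigma> n) (y n)"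
      by (simp only: subst_seq_pow_Suc(2)[OF subst] assms(2)[of n, symmetric])
    with Suc show ?case by simp
  qed simp
  have "\<exists>z\<in>subst_shift \<sigma>. y 0 = subst_seq (subst_pow \<sigma> (Suc n)) z \<and>
    (y (Suc n) (-1), y (Suc n) 0) = (z (-1), z 0) \<and>
    (y n (-1), y n 0) = (subst_seq \<sigma> z (-1), subst_seq \<sigma> z 0)" for n
    using assms(1)[of "Suc n"] assms(2)[of n] pow[of "Suc n"] by metis
  from w_Lambda_of_boundaries[of "y 0" "\<lambda>n. (y n (-1), y n 0)", OF this]
  show ?thesis by (metis imageI)
qed

text \<open>Finitely many distinct elements of \<open>\<Lambda>\<close> are pairwise distinct at a common level \<open>n\<close>, so their
  number is at most the number of pairs of letters.\<close>

lemma finite_Lambda_seqs: "finite (Lambda_seqs \<sigma>)"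
proof (rule ccontr)
  assume "infinite (Lambda_seqs \<sigma>)"
  then obtain F where F: "F \<subseteq> Lambda_seqs \<sigma>" "finite F" "card F = Suc (card (UNIV :: ('a \<times> 'a) set))"
    using infinite_arbitrarily_large by metis
  have down: "s k = t k" if "s \<in> Lambda_seqs \<sigma>" "t \<in> Lambda_seqs \<sigma>" "s n = t n" "k \<le> n" for s t k n
    using that(4,3)
  proof (induction rule: inc_induct)
    case (step k)
    with that(1,2) have "s (Suc k) = t (Suc k)" by simp
    then show ?case
      using Lambda_seqsD(2,3)[OF that(1), of k] Lambda_seqsD(2,3)[OF that(2), of k]
      by (simp add: prod_eq_iff)
  qed
  have "\<forall>s\<in>F. \<forall>t\<in>F. \<exists>k. s \<noteq> t \<longrightarrow> s k \<noteq> t k" by (auto simp: fun_eq_iff)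
  then obtain d where d: "\<And>s t. s \<in> F \<Longrightarrow> t \<in> F \<Longrightarrow> s \<noteq> t \<Longrightarrow> s (d s t) \<noteq> t (d s t)"
    by metis
  define n where "n = Max ((\<lambda>(s, t). d s t) ` (F \<times> F))"
  have n: "d s t \<le> n" if "s \<in> F" "t \<in> F" for s t
    unfolding n_def by (rule Max_ge) (use that F(2) in auto)
  have "inj_on (\<lambda>s. s n) F"
  proof (rule inj_onI, rule ccontr)
    fix s t assume st: "s \<in> F" "t \<in> F" "s n = t n" "s \<noteq> t"
    then have "s (d s t) = t (d s t)" using down[of s t n "d s t"] n F(1) by blast
    with d st show False by blast
  qed
  then have "card F \<le> card (UNIV :: ('a \<times> 'a) set)"
    by (metis card_image card_mono finite subset_UNIV)
  with F(3) show False by simp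
qed

text \<open>For each \<open>n\<close> an \<open>n\<close>-fold preimage \<open>y n\<close> yields intermediate preimages \<open>z n k\<close> for \<open>k \<le> n\<close>. Compactness is
  applied to their pairs of letters at the origin, which take finitely many values.\<close>

lemma all_images_imp_w_Lambda:
  assumes "\<And>n. x \<in> (subst_seq \<sigma> ^^ n) ` subst_shift \<sigma>"
  shows "x \<in> w_Lambda \<sigma> ` Lambda_seqs \<sigma>"
proof -
  obtain y where y: "\<And>n. y n \<in> subst_shift \<sigma>" "\<And>n. x = subst_seq (subst_pow \<sigma> n) (y n)"
    using assms unfolding image_iff funpow_subst_seq[OF subst] by metis
  \<comment> \<open>Only indices \<open>n > k\<close> are chosen below, so the difference is a true one there.\<close>
  define z where "z = (\<lambda>n k. subst_seq (subst_pow \<sigma> (n - k)) (y n))"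
  obtain s where s: "\<And>k. infinite {n. \<forall>j<k. (z n j (-1), z n j 0) = s j}"
    using compactness[of "\<lambda>n j. (z n j (-1), z n j 0)"] by auto
  have "\<exists>u\<in>subst_shift \<sigma>. x = subst_seq (subst_pow \<sigma> (Suc k)) u \<and>
    s (Suc k) = (u (-1), u 0) \<and> s k = (subst_seq \<sigma> u (-1), subst_seq \<sigma> u 0)" for k
  proof -
    obtain n where n: "n \<ge> Suc k" "\<forall>j<Suc (Suc k). (z n j (-1), z n j 0) = s j"
      using s[of "Suc (Suc k)"] unfolding infinite_nat_iff_unbounded_le by blast
    have zx: "x = subst_seq (subst_pow \<sigma> j) (z n j)" if "j \<le> n" for j
      using y(2)[of n] that subst_seq_comp[of "subst_pow \<sigma> j" "subst_pow \<sigma> (n - j)" "y n"]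
      by (simp add: z_def substitution_subst_pow[OF subst] flip: subst_pow_add)
    have "n - k = Suc (n - Suc k)" using n(1) by simp
    then have "z n k = subst_seq \<sigma> (z n (Suc k))"
      by (simp add: z_def subst_seq_pow_Suc(1)[OF subst])
    moreover have "z n (Suc k) \<in> subst_shift \<sigma>"
      unfolding z_def by (rule subst_seq_pow_in_subst_shift[OF subst y(1)])
    ultimately show ?thesis
      using n(2)[rule_format, of k] n(2)[rule_format, of "Suc k"] zx[OF n(1)] by auto
  qed
  from w_Lambda_of_boundaries[OF this] show ?thesis by blast
qed

subsection \<open>The sequences attached to \<open>\<M>\<close> and the decomposition of the subshift\<close>

lemma length_subst_word_take:
  "i \<le> length u \<Longrightarrow> length (subst_word \<tau> (take i u)) = (\<Sum>k<i. length (\<tau> (u ! k)))"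
  by (induction i) (simp_all add: take_Suc_conv_app_nth subst_word_append, simp_all add: subst_word_def)

text \<open>The image \<open>\<sigma>(a\<^sub>n\<^sub>+\<^sub>1)\<close> is split at its letter number \<open>i\<^sub>n\<^sub>+\<^sub>1\<close>, which is \<open>a\<^sub>n\<close>. The sum in the recursion for
  \<open>j\<close> is the length of \<open>\<sigma>\<^sup>n\<close> of the part before that letter.\<close>

lemma M_nested:
  assumes "m \<in> M_seqs \<sigma>"
  shows "\<exists>p q. subst_pow \<sigma> (Suc n) (fst (m (Suc n))) = p @ subst_pow \<sigma> n (fst (m n)) @ q
    \<and> j_pos \<sigma> m (Suc n) = length p + j_pos \<sigma> m n"
proof -
  define i where "i = snd (m (Suc n))"
  define u where "u = \<sigma> (fst (m (Suc n)))"
  have i: "i < length u" "u ! i = fst (m n)"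
    using assms by (simp_all add: M_seqs_def i_def u_def)
  have "u = take i u @ [fst (m n)] @ drop (Suc i) u"
    using id_take_nth_drop[OF i(1)] i(2) by simp
  then have "subst_word (subst_pow \<sigma> n) u = subst_word (subst_pow \<sigma> n) (take i u) @
      subst_word (subst_pow \<sigma> n) [fst (m n)] @ subst_word (subst_pow \<sigma> n) (drop (Suc i) u)"
    by (metis subst_word_append)
  moreover have "j_pos \<sigma> m (Suc n) = length (subst_word (subst_pow \<sigma> n) (take i u)) + j_pos \<sigma> m n"
    using i(1) by (simp add: length_subst_word_take i_def u_def)
  ultimately show ?thesis
    by (intro exI[of _ "subst_word (subst_pow \<sigma> n) (take i u)"]
        exI[of _ "subst_word (subst_pow \<sigma> n) (drop (Suc i) u)"])
      (simp add: subst_pow_Suc u_def subst_word_def)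
qed

lemma w_M_ex1:
  assumes "m \<in> M0_seqs \<sigma>"
  shows "\<exists>!w. \<forall>n. window w (- int (j_pos \<sigma> m n))
               (int (length (subst_pow \<sigma> n (fst (m n)))) - int (j_pos \<sigma> m n) - 1)
        = subst_pow \<sigma> n (fst (m n))"
  using assms unfolding M0_seqs_def
  by (intro nested_words_limit M_nested filterlim_compose[OF filterlim_int_sequentially]) auto

lemma w_M_eqI:
  assumes "m \<in> M0_seqs \<sigma>"
    and "\<And>n. window w (- int (j_pos \<sigma> m n))
               (int (length (subst_pow \<sigma> n (fst (m n)))) - int (j_pos \<sigma> m n) - 1)
        = subst_pow \<sigma> n (fst (m n))"
  shows "w_M \<sigma> m = w"
  unfolding w_M_def by (rule the1_equality[OF w_M_ex1]) (use assms in auto)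

lemma w_M_in_subst_shift:
  assumes "m \<in> M0_seqs \<sigma>"
  shows "w_M \<sigma> m \<in> subst_shift \<sigma>"
proof (rule in_subst_shift_if_windows)
  show "window (w_M \<sigma> m) (- int (j_pos \<sigma> m n))
      (int (length (subst_pow \<sigma> n (fst (m n)))) - int (j_pos \<sigma> m n) - 1) \<in> language \<sigma>"
    if "n \<ge> 1" for n
    using theI'[OF w_M_ex1[OF assms]] subst_pow_in_language[OF that] unfolding w_M_def by metis
qed (use assms in \<open>auto simp: M0_seqs_def intro: filterlim_compose[OF filterlim_int_sequentially]\<close>)

text \<open>The blocks \<open>\<sigma>\<^sup>n(a\<^sub>n)\<close> over the origin grow with \<open>n\<close>. They exhaust the point unless they stop growing on
  one side, and then the boundary at which they stop is a boundary between blocks at all later levels.\<close>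

lemma subst_shift_decompose:
  assumes "x \<in> subst_shift \<sigma>"
  shows "x \<in> w_M \<sigma> ` M0_seqs \<sigma> \<union> (\<Union>s\<in>Lambda_seqs \<sigma>. shift_orbit (w_Lambda \<sigma> s))"
proof -
  have "\<exists>f. \<forall>n. (fst (f n) \<in> subst_shift \<sigma> \<and> (n = 0 \<longrightarrow> f n = (x, 0))) \<and>
    (snd (f (Suc n)) < length (\<sigma> (fst (f (Suc n)) 0)) \<and>
     fst (f n) = shift_by (int (snd (f (Suc n)))) (subst_seq \<sigma> (fst (f (Suc n)))))"
  proof (rule dependent_nat_choice)
    show "\<exists>p. fst p \<in> subst_shift \<sigma> \<and> ((0::nat) = 0 \<longrightarrow> p = (x, 0::nat))"
      using assms by auto
  next
    fix p :: "(int \<Rightarrow> 'a) \<times> nat" and n :: nat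
    assume "fst p \<in> subst_shift \<sigma> \<and> (n = 0 \<longrightarrow> p = (x, 0))"
    then obtain k y where "y \<in> subst_shift \<sigma>" "k < length (\<sigma> (y 0))"
      "fst p = shift_by (int k) (subst_seq \<sigma> y)"
      using desubstitution[OF subst, of "fst p"] by blast
    then show "\<exists>q. (fst q \<in> subst_shift \<sigma> \<and> (Suc n = 0 \<longrightarrow> q = (x, 0))) \<and>
      snd q < length (\<sigma> (fst q 0)) \<and> fst p = shift_by (int (snd q)) (subst_seq \<sigma> (fst q))"
      by (intro exI[of _ "(y, k)"]) simp
  qed
  then obtain f where f: "\<forall>n. (fst (f n) \<in> subst_shift \<sigma> \<and> (n = 0 \<longrightarrow> f n = (x, 0))) \<and>
    (snd (f (Suc n)) < length (\<sigma> (fst (f (Suc n)) 0)) \<and>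
     fst (f n) = shift_by (int (snd (f (Suc n)))) (subst_seq \<sigma> (fst (f (Suc n)))))" ..
  define y where "y n = fst (f n)" for n
  define k where "k n = snd (f n)" for n
  have y: "y n \<in> subst_shift \<sigma>" "k (Suc n) < length (\<sigma> (y (Suc n) 0))"
    "y n = shift_by (int (k (Suc n))) (subst_seq \<sigma> (y (Suc n)))" for n
    using f unfolding y_def k_def by blast+
  have init: "y 0 = x" "k 0 = 0" using f[rule_format, of 0] by (simp_all add: y_def k_def)
  define m where "m n = (y n 0, k n)" for n
  have take: "window (subst_seq \<sigma> (y (Suc n))) 0 (int (k (Suc n)) - 1)
      = take (k (Suc n)) (\<sigma> (y (Suc n) 0))"
    and nth: "\<sigma> (y (Suc n) 0) ! k (Suc n) = y n 0" for n
  proof -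
    have "\<sigma> (y (Suc n) 0) ! i = subst_seq \<sigma> (y (Suc n)) (int i)" if "i \<le> k (Suc n)" for i
      using that y(2)[of n]
      by (subst window_subst_seq_letter[OF subst, symmetric], subst window_nth) simp_all
    with y(2)[of n] show "window (subst_seq \<sigma> (y (Suc n))) 0 (int (k (Suc n)) - 1)
        = take (k (Suc n)) (\<sigma> (y (Suc n) 0))" "\<sigma> (y (Suc n) 0) ! k (Suc n) = y n 0"
      by (intro nth_equalityI, simp_all add: length_window window_nth y(3)[of n] shift_by_def)
  qed
  have mM: "m \<in> M_seqs \<sigma>"
    using nth y(2) init by (simp add: M_seqs_def m_def)
  define j where "j = j_pos \<sigma> m"
  define r where "r n = length (subst_pow \<sigma> n (y n 0)) - j n" for n
  have xj: "x = shift_by (int (j n)) (subst_seq (subst_pow \<sigma> n) (y n))" for n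
  proof (induction n)
    case 0
    show ?case by (simp add: j_def init shift_by_def)
  next
    case (Suc n)
    let ?c = "cut_pos (subst_pow \<sigma> n) (subst_seq \<sigma> (y (Suc n))) (int (k (Suc n)))"
    have "int (j (Suc n)) = ?c + int (j n)"
      using cut_pos_diff[of 0 "int (k (Suc n))" "subst_pow \<sigma> n" "subst_seq \<sigma> (y (Suc n))"] y(2)[of n]
      by (simp add: j_def m_def take length_subst_word_take)
    moreover have "subst_seq (subst_pow \<sigma> n) (y n)
        = shift_by ?c (subst_seq (subst_pow \<sigma> (Suc n)) (y (Suc n)))"
      by (subst y(3)) (simp only: subst_seq_shift_by[OF substitution_subst_pow[OF subst]]
          subst_seq_pow_Suc(2)[OF subst])
    ultimately show ?case using Suc.IH by (simp only: shift_by_shift_by)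
  qed
  have nest: "\<exists>p q. subst_pow \<sigma> (Suc n) (y (Suc n) 0) = p @ subst_pow \<sigma> n (y n 0) @ q
      \<and> j (Suc n) = length p + j n" for n
    using M_nested[OF mM, of n] by (simp add: m_def j_def)
  have jle: "j n < length (subst_pow \<sigma> n (y n 0))" for n
  proof (induction n)
    case (Suc n)
    then show ?case using nest[of n] by auto
  qed (simp add: j_def)
  have jmono: "j n \<le> j (Suc n)" and rmono: "r n \<le> r (Suc n)" for n
    using nest[of n] by (auto simp: r_def)
  \<comment> \<open>Common to the last two cases. The tower starts only at level \<open>N\<close>; applying \<open>\<sigma>\<^sup>N\<close> to all of its members
    gives a tower over \<open>\<sigma>\<^sup>N(z\<^sub>0)\<close>.\<close>
  have orbit: "x \<in> (\<Union>s\<in>Lambda_seqs \<sigma>. shift_orbit (w_Lambda \<sigma> s))"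
    if z: "\<And>n. z n \<in> subst_shift \<sigma>" "\<And>n. z n = subst_seq \<sigma> (z (Suc n))"
      "x = shift_by c (subst_seq (subst_pow \<sigma> N) (z 0))" for z c N
  proof -
    have "subst_seq (subst_pow \<sigma> N) (z 0) \<in> w_Lambda \<sigma> ` Lambda_seqs \<sigma>"
    proof (rule w_Lambda_of_tower[of "\<lambda>n. subst_seq (subst_pow \<sigma> N) (z n)"])
      show "subst_seq (subst_pow \<sigma> N) (z n) = subst_seq \<sigma> (subst_seq (subst_pow \<sigma> N) (z (Suc n)))" for n
        by (subst z(2)) (simp only: subst_seq_pow_Suc[OF subst, symmetric])
    qed (rule subst_seq_pow_in_subst_shift[OF subst z(1)])
    then obtain s where s: "s \<in> Lambda_seqs \<sigma>" "subst_seq (subst_pow \<sigma> N) (z 0) = w_Lambda \<sigma> s"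
      by blast
    have "x \<in> shift_orbit (w_Lambda \<sigma> s)"
      unfolding shift_orbit_def using z(3) s(2) by (intro range_eqI[of _ _ c]) simp
    with s(1) show ?thesis by (intro UN_I[of s])
  qed
  consider "filterlim j at_top sequentially" "filterlim r at_top sequentially"
    | "\<not> filterlim j at_top sequentially" | "\<not> filterlim r at_top sequentially" by blast
  then show ?thesis
  proof cases
    case 1
    have "filterlim (\<lambda>n. int (length (subst_pow \<sigma> n (fst (m n)))) - int (j n)) at_top sequentially"
      using filterlim_compose[OF filterlim_int_sequentially 1(2)] jle
      by (simp add: r_def m_def of_nat_diff less_imp_le)
    then have m0: "m \<in> M0_seqs \<sigma>" using mM 1(1) by (simp add: M0_seqs_def j_def)
    have "window x (- int (j n)) (int (length (subst_pow \<sigma> n (y n 0))) - int (j n) - 1)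
        = subst_pow \<sigma> n (y n 0)" for n
      using window_subst_seq_letter[OF substitution_subst_pow[OF subst], of n "y n"]
      by (subst xj[of n]) (simp add: window_shift_by)
    then have "w_M \<sigma> m = x" by (intro w_M_eqI[OF m0]) (simp add: j_def m_def)
    with m0 show ?thesis by blast
  next
    case 2
    then obtain N where N: "\<And>n. n \<ge> N \<Longrightarrow> j n = j N" using mono_nat_eventually_const[of j] jmono by blast
    have k0: "k (Suc n) = 0" if "n \<ge> N" for n
    proof (rule ccontr)
      assume "k (Suc n) \<noteq> 0"
      then have "take (k (Suc n)) (\<sigma> (y (Suc n) 0)) \<noteq> []"
        using y(2)[of n] by auto
      then have "length (subst_word (subst_pow \<sigma> n) (take (k (Suc n)) (\<sigma> (y (Suc n) 0)))) \<noteq> 0"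
        using subst_word_eq_Nil[OF substitution_subst_pow[OF subst]] by simp
      moreover have "j (Suc n) = length (subst_word (subst_pow \<sigma> n)
          (take (k (Suc n)) (\<sigma> (y (Suc n) 0)))) + j n"
        using y(2)[of n] by (simp add: j_def m_def length_subst_word_take)
      ultimately show False using N[of n] N[of "Suc n"] that by simp
    qed
    have "x \<in> (\<Union>s\<in>Lambda_seqs \<sigma>. shift_orbit (w_Lambda \<sigma> s))"
    proof (rule orbit[of "\<lambda>n. y (n + N)"])
      show "y (n + N) = subst_seq \<sigma> (y (Suc n + N))" for n
        using y(3)[of "n + N"] k0[of "n + N"] by (simp add: shift_by_def)
      show "x = shift_by (int (j N)) (subst_seq (subst_pow \<sigma> N) (y (0 + N)))"
        using xj[of N] by simp
    qed (rule y(1))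
    then show ?thesis by blast
  next
    case 3
    then obtain N where N: "\<And>n. n \<ge> N \<Longrightarrow> r n = r N" using mono_nat_eventually_const[of r] rmono by blast
    have k1: "Suc (k (Suc n)) = length (\<sigma> (y (Suc n) 0))" if "n \<ge> N" for n
    proof (rule ccontr)
      let ?u = "\<sigma> (y (Suc n) 0)"
      assume "Suc (k (Suc n)) \<noteq> length ?u"
      then have "drop (Suc (k (Suc n))) ?u \<noteq> []" using y(2)[of n] by auto
      then have pos: "length (subst_word (subst_pow \<sigma> n) (drop (Suc (k (Suc n))) ?u)) \<noteq> 0"
        using subst_word_eq_Nil[OF substitution_subst_pow[OF subst]] by simp
      have "?u = take (k (Suc n)) ?u @ [y n 0] @ drop (Suc (k (Suc n))) ?u"
        using id_take_nth_drop[OF y(2)[of n]] nth[of n] by simp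
      then have "length (subst_word (subst_pow \<sigma> n) ?u) =
          length (subst_word (subst_pow \<sigma> n) (take (k (Suc n)) ?u)) +
          (length (subst_word (subst_pow \<sigma> n) [y n 0]) +
           length (subst_word (subst_pow \<sigma> n) (drop (Suc (k (Suc n))) ?u)))"
        by (metis subst_word_append length_append)
      moreover have "j (Suc n) = length (subst_word (subst_pow \<sigma> n) (take (k (Suc n)) ?u)) + j n"
        using y(2)[of n] by (simp add: j_def m_def length_subst_word_take)
      ultimately have "r (Suc n) = r n + length (subst_word (subst_pow \<sigma> n) (drop (Suc (k (Suc n))) ?u))"
        using jle[of n] by (simp add: r_def subst_pow_Suc subst_word_def)
      with pos N[of n] N[of "Suc n"] that show False by simp
    qed
    \<comment> \<open>The tracked letter is always the last one of its block, so the boundary after it persists, and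
      shifting by one moves this boundary to the origin.\<close>
    let ?z = "\<lambda>n. shift_by 1 (y (n + N))"
    have "x \<in> (\<Union>s\<in>Lambda_seqs \<sigma>. shift_orbit (w_Lambda \<sigma> s))"
    proof (rule orbit[of ?z])
      show "?z n = subst_seq \<sigma> (?z (Suc n))" for n
      proof -
        have "cut_pos \<sigma> (y (Suc n + N)) 1 = 1 + int (k (Suc n + N))"
          using cut_pos_diff[of 0 1 \<sigma> "y (Suc n + N)"] k1[of "n + N"]
          by (simp add: window_def subst_word_def)
        then show ?thesis
          using y(3)[of "n + N"] by (simp add: subst_seq_shift_by[OF subst] shift_by_shift_by add.commute)
      qed
      show "x = shift_by (int (j N) - cut_pos (subst_pow \<sigma> N) (y N) 1)
          (subst_seq (subst_pow \<sigma> N) (?z 0))"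
        using xj[of N]
        by (simp add: subst_seq_shift_by[OF substitution_subst_pow[OF subst]] shift_by_shift_by)
    qed (rule shift_by_in_subst_shift[OF y(1)])
    then show ?thesis by blast
  qed
qed

end

theorem theoremA1:
  fixes \<sigma> :: "'a::finite \<Rightarrow> 'a list"
  assumes "substitution \<sigma>"
    and "uncountable (subst_shift \<sigma>)"
    and "filterlim (\<lambda>n. subst_len (subst_pow \<sigma> n)) at_top sequentially"
  shows "(subst_shift \<sigma> =
            w_M \<sigma> ` M0_seqs \<sigma> \<union> (\<Union>s\<in>Lambda_seqs \<sigma>. shift_orbit (w_Lambda \<sigma> s)))
    \<and> finite (w_Lambda \<sigma> ` Lambda_seqs \<sigma>)
    \<and> (aperiodic \<sigma> \<longrightarrow>
            (\<Inter>n. (subst_seq \<sigma> ^^ n) ` subst_shift \<sigma>) = w_Lambda \<sigma> ` Lambda_seqs \<sigma>)"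
proof -
  interpret growing_substitution \<sigma>
    using assms by unfold_locales
  have "w_M \<sigma> ` M0_seqs \<sigma> \<union> (\<Union>s\<in>Lambda_seqs \<sigma>. shift_orbit (w_Lambda \<sigma> s)) \<subseteq> subst_shift \<sigma>"
    by (auto simp: shift_orbit_def w_M_in_subst_shift w_Lambda_in_subst_shift shift_by_in_subst_shift)
  then have "subst_shift \<sigma> =
      w_M \<sigma> ` M0_seqs \<sigma> \<union> (\<Union>s\<in>Lambda_seqs \<sigma>. shift_orbit (w_Lambda \<sigma> s))"
    by (intro equalityI subsetI[OF subst_shift_decompose])
  moreover have "(\<Inter>n. (subst_seq \<sigma> ^^ n) ` subst_shift \<sigma>) = w_Lambda \<sigma> ` Lambda_seqs \<sigma>"
    by (intro equalityI subsetI INT_I all_images_imp_w_Lambda) (auto intro: w_Lambda_in_images)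
  ultimately show ?thesis by (simp add: finite_Lambda_seqs)
qed

end
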